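(* Every $3$-connected planar graph $G$ contains a subgraph $H$ isomorphic to a subdivision of $K_4$ such that $G-V(H)$ has fewer than two connected components.
   Context: A subdivision of $K_4$ is a graph obtained from $K_4$ by replacing its edges by internally disjoint paths. *)

theory Defs
  imports "HOL-Analysis.Analysis" "Graph_Theory.Graph_Theory"
begin

text \<open>
  Finite simple graphs are modelled by the locale \<open>pair_graph\<close>: an undirected edge is a pair of
  opposite arcs.
\<close>

definition delete_verts :: "'a pair_pre_digraph \<Rightarrow> 'a set \<Rightarrow> ('a, 'a \<times> 'a) pre_digraph" where
  "delete_verts G X = with_proj G \<restriction> (pverts G - X)"

definition k_connected :: "nat \<Rightarrow> 'a pair_pre_digraph \<Rightarrow> bool" where
  "k_connected k G \<longleftrightarrow>
     k < card (pverts G) \<and>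
     (\<forall>X \<subseteq> pverts G. card X < k \<longrightarrow> Digraph_Component.connected (delete_verts G X))"

text \<open>
  A plane drawing puts the vertices at distinct points of the plane and draws every edge as a
  simple arc between its ends whose interior contains no vertex and no point of another edge.
  The two opposite arcs of an edge are drawn along the same curve.
\<close>

definition plane_drawing ::
    "'a pair_pre_digraph \<Rightarrow> ('a \<Rightarrow> complex) \<Rightarrow> ('a \<times> 'a \<Rightarrow> real \<Rightarrow> complex) \<Rightarrow> bool" where
  "plane_drawing G p g \<longleftrightarrow>
     inj_on p (pverts G) \<and>
     (\<forall>(u, v) \<in> parcs G.
        arc (g (u, v)) \<and> pathstart (g (u, v)) = p u \<and> pathfinish (g (u, v)) = p v \<and>
        g (v, u) = reversepath (g (u, v)) \<and>
        (path_image (g (u, v)) - {p u, p v}) \<inter> p ` pverts G = {} \<and>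
        (\<forall>(x, y) \<in> parcs G. {x, y} \<noteq> {u, v} \<longrightarrow>
           (path_image (g (u, v)) - {p u, p v}) \<inter> path_image (g (x, y)) = {}))"

definition planar :: "'a pair_pre_digraph \<Rightarrow> bool" where
  "planar G \<longleftrightarrow> (\<exists>p g. plane_drawing G p g)"

text \<open>
  \<open>K\<close> is a copy of $K_4$ on the four branch vertices of \<open>H\<close>, so that the predicate is invariant
  under isomorphism. The library's \<open>subdivision\<close> inserts the inner vertices of the paths that
  replace the edges of \<open>K\<close> one at a time.
\<close>

definition K4_subdivision :: "'a pair_pre_digraph \<Rightarrow> bool" where
  "K4_subdivision H \<longleftrightarrow> (\<exists>K. complete_digraph 4 (with_proj K) \<and> subdivision_pair K H)"

text \<open>
  In a symmetric digraph the strongly connected components are the connected components of the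
  underlying graph; by definition a component is nonempty, so the empty graph has none.
\<close>

definition num_components :: "('a, 'b) pre_digraph \<Rightarrow> nat" where
  "num_components G = card (pre_digraph.sccs G)"

end

theory Submission
  imports Defs
begin

text \<open>
  Grow a cycle, starting from a single edge, such that it spans its vertex set \<open>W\<close> and the rest
  \<open>V - W\<close> stays connected. By 3-connectedness there is always an ear \<open>A\<close>, a path through \<open>V - W\<close>
  between two vertices \<open>a \<noteq> b\<close> of the cycle, whose removal leaves the rest connected. If \<open>a\<close> and \<open>b\<close>
  are consecutive, the ear is inserted into the cycle. Otherwise \<open>a\<close> and \<open>b\<close> cut the cycle into two
  nonempty segments. An edge between the segments, or from \<open>A\<close> to a third vertex of the cycle, yields
  a subdivision of $K_4$ that spans \<open>W \<union> A\<close>. If there is no such edge, then each segment is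
  adjacent to the rest, since \<open>{a, b}\<close> is not a separator, and so is \<open>A\<close>; contracting the rest
  exhibits a $K_{3,3}$, which is impossible in a plane graph.
\<close>

subsection \<open>Theta curves in the plane\<close>

text \<open>The two arcs form a Jordan curve, and the connected set \<open>T\<close> misses it, so
  \<open>T\<close> lies on one side; \<open>M\<close> is the other one. Each side has the whole
  curve as its frontier. Choosing \<open>M\<close> relative to \<open>T\<close> avoids telling
  inside from outside later.\<close>

lemma Jordan_curve_avoid:
  fixes c1 c2 :: "real \<Rightarrow> complex"
  assumes "arc c1" "pathstart c1 = a" "pathfinish c1 = b"
    and "arc c2" "pathstart c2 = a" "pathfinish c2 = b"
    and "path_image c1 \<inter> path_image c2 \<subseteq> {a, b}"
    and "Topological_Spaces.connected T" "T \<noteq> {}" "T \<inter> (path_image c1 \<union> path_image c2) = {}"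
  obtains M where "M \<noteq> {}" "Topological_Spaces.connected M" "M \<inter> T = {}"
    "M \<inter> (path_image c1 \<union> path_image c2) = {}"
    "path_image c1 \<union> path_image c2 \<subseteq> closure M"
    "\<And>x y. x \<in> M \<Longrightarrow> y \<in> T \<Longrightarrow> \<not> connected_component (- (path_image c1 \<union> path_image c2)) x y"
proof -
  let ?c = "c1 +++ reversepath c2"
  have "simple_path ?c"
    using assms by (auto simp: simple_path_join_loop_eq arc_reversepath)
  moreover have "pathfinish ?c = pathstart ?c"
    using assms by simp
  moreover have img: "path_image ?c = path_image c1 \<union> path_image c2"
    using assms by (simp add: path_image_join)
  ultimately obtain I Out where IO: "I \<noteq> {}" "open I" "Topological_Spaces.connected I"
      "Out \<noteq> {}" "open Out" "Topological_Spaces.connected Out" "I \<inter> Out = {}"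
      "I \<union> Out = - (path_image c1 \<union> path_image c2)"
      "frontier I = path_image c1 \<union> path_image c2" "frontier Out = path_image c1 \<union> path_image c2"
    by (metis Jordan_curve)
  have sep: "\<not> connected_component (- (path_image c1 \<union> path_image c2)) x y"
    if "x \<in> I" "y \<in> Out" for x y
  proof
    assume "connected_component (- (path_image c1 \<union> path_image c2)) x y"
    then obtain S where "Topological_Spaces.connected S" "S \<subseteq> I \<union> Out" "x \<in> S" "y \<in> S"
      using IO by (auto simp: connected_component_def)
    then show False
      using connectedD[of S I Out] IO that by blast
  qed
  have "T \<subseteq> I \<or> T \<subseteq> Out"
  proof -
    have "T \<subseteq> I \<union> Out" unfolding IO(8) using assms(10) by blast
    moreover have "I \<inter> Out \<inter> T = {}" using IO(7) by blast
    ultimately show ?thesis using connectedD[OF assms(8) IO(2,5)] by blast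
  qed
  then show thesis
  proof
    assume T: "T \<subseteq> I"
    show thesis
    proof (rule that[of Out])
      show "path_image c1 \<union> path_image c2 \<subseteq> closure Out"
        using IO by (metis closure_Un_frontier Un_upper2)
      show "\<not> connected_component (- (path_image c1 \<union> path_image c2)) x y"
        if "x \<in> Out" "y \<in> T" for x y
        using sep[of y x] that T connected_component_sym by blast
    qed (use IO T in auto)
  next
    assume T: "T \<subseteq> Out"
    show thesis
    proof (rule that[of I])
      show "path_image c1 \<union> path_image c2 \<subseteq> closure I"
        using IO by (metis closure_Un_frontier Un_upper2)
      show "\<not> connected_component (- (path_image c1 \<union> path_image c2)) x y"
        if "x \<in> I" "y \<in> T" for x y
        using sep[of x y] that T by blast
    qed (use IO T in auto)
  qed
qed

text \<open>Adding to \<open>S\<close> a point of its closure that lies in \<open>T\<close> keeps it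
  connected, and then it shares that point with \<open>T\<close>.\<close>

lemma connected_Un_closure:
  assumes "Topological_Spaces.connected S" "Topological_Spaces.connected T" "closure S \<inter> T \<noteq> {}"
  shows "Topological_Spaces.connected (S \<union> T)"
proof -
  obtain x where x: "x \<in> closure S" "x \<in> T" using assms by auto
  have "Topological_Spaces.connected (insert x S)"
    using assms(1) by (rule connected_intermediate_closure) (use x closure_subset in auto)
  then have "Topological_Spaces.connected (insert x S \<union> T)"
    using assms(2) x by (intro connected_Un) auto
  then show ?thesis using x by (simp add: insert_absorb)
qed

text \<open>
  Let \<open>M\<close> be the side of the curve \<open>c1 \<union> c2\<close> that does not contain \<open>U\<close> and \<open>c3\<close>. A point of \<open>M\<close> is
  joined to \<open>U\<close> across the interior of \<open>c2\<close> without meeting \<open>c1 \<union> c3\<close>, and across the interior of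
  \<open>c1\<close> without meeting \<open>c2 \<union> c3\<close>. These two curves intersect in the arc \<open>c3\<close>, so by Janiszewski's
  theorem their union does not separate \<open>M\<close> from \<open>U\<close> although it contains \<open>c1 \<union> c2\<close>.
\<close>

lemma theta_curve_face:
  fixes c1 c2 c3 :: "real \<Rightarrow> complex"
  assumes c1: "arc c1" "pathstart c1 = a" "pathfinish c1 = b"
    and c2: "arc c2" "pathstart c2 = a" "pathfinish c2 = b"
    and c3: "arc c3" "pathstart c3 = a" "pathfinish c3 = b"
    and disj: "path_image c1 \<inter> path_image c2 \<subseteq> {a, b}" "path_image c1 \<inter> path_image c3 \<subseteq> {a, b}"
      "path_image c2 \<inter> path_image c3 \<subseteq> {a, b}"
    and U: "Topological_Spaces.connected U" "U \<inter> (path_image c1 \<union> path_image c2 \<union> path_image c3) = {}"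
    and touch: "closure U \<inter> (path_image c1 - {a, b}) \<noteq> {}" "closure U \<inter> (path_image c2 - {a, b}) \<noteq> {}"
      "closure U \<inter> (path_image c3 - {a, b}) \<noteq> {}"
  shows False
proof -
  let ?o = "\<lambda>c. path_image c - {a, b}"
  have con: "Topological_Spaces.connected (?o c)" if "arc c" "pathstart c = a" "pathfinish c = b" for c
    using connected_simple_path_endless[of c] that by (auto simp: arc_imp_simple_path)
  have ends: "a \<in> path_image c" "b \<in> path_image c" if "pathstart c = a" "pathfinish c = b" for c
    using that by auto
  have "Topological_Spaces.connected (U \<union> ?o c3)"
    using U(1) con[OF c3] touch(3) by (rule connected_Un_closure)
  moreover have "U \<union> ?o c3 \<noteq> {}" using touch by auto
  moreover have "(U \<union> ?o c3) \<inter> (path_image c1 \<union> path_image c2) = {}"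
    using U disj by blast
  ultimately obtain M where M: "M \<noteq> {}" "Topological_Spaces.connected M" "M \<inter> (U \<union> ?o c3) = {}"
    "M \<inter> (path_image c1 \<union> path_image c2) = {}" "path_image c1 \<union> path_image c2 \<subseteq> closure M"
    "\<And>x y. x \<in> M \<Longrightarrow> y \<in> U \<union> ?o c3 \<Longrightarrow> \<not> connected_component (- (path_image c1 \<union> path_image c2)) x y"
    using Jordan_curve_avoid[OF c1 c2 disj(1)] by metis
  obtain x where x: "x \<in> M" using M by auto
  have "U \<noteq> {}" using touch by auto
  then obtain y where y: "y \<in> U" by auto
  have M3: "M \<inter> path_image c3 = {}"
    using M ends[OF c1(2,3)] by blast
  \<comment> \<open>Stated for a pair \<open>c\<close>, \<open>d\<close> because it is used in both
    orders: \<open>d\<close> is the arc that is crossed, \<open>c\<close> the one that is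
    avoided.\<close>
  have join: "connected_component (- (path_image c \<union> path_image c3)) x y"
    if c: "arc c" "pathstart c = a" "pathfinish c = b" and d: "arc d" "pathstart d = a" "pathfinish d = b"
      and cd: "path_image c \<inter> path_image d \<subseteq> {a, b}" "path_image d \<inter> path_image c3 \<subseteq> {a, b}"
        "closure U \<inter> ?o d \<noteq> {}" "path_image c \<union> path_image d = path_image c1 \<union> path_image c2" for c d
  proof -
    have "Topological_Spaces.connected (U \<union> ?o d)"
      using U(1) con[OF d] cd(3) by (rule connected_Un_closure)
    moreover have "?o d \<subseteq> closure M" "?o d \<noteq> {}"
      using cd(3,4) M(5) by blast+
    then have "closure M \<inter> (U \<union> ?o d) \<noteq> {}"
      by blast
    ultimately have "Topological_Spaces.connected (M \<union> (U \<union> ?o d))"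
      using M(2) by (rule_tac connected_Un_closure)
    moreover have "M \<inter> path_image c = {}" "U \<inter> path_image c = {}"
      using M(4) U(2) cd(4) by blast+
    then have "M \<union> (U \<union> ?o d) \<subseteq> - (path_image c \<union> path_image c3)"
      using M3 U(2) cd(1,2) by blast
    ultimately show ?thesis
      using x y unfolding connected_component_def by blast
  qed
  have "connected_component (- ((path_image c1 \<union> path_image c3) \<union> (path_image c2 \<union> path_image c3))) x y"
  proof (rule Janiszewski)
    show "compact (path_image c1 \<union> path_image c3)" "closed (path_image c2 \<union> path_image c3)"
      using c1 c2 c3 by (auto simp: compact_Un compact_arc_image closed_arc_image)
    have "(path_image c1 \<union> path_image c3) \<inter> (path_image c2 \<union> path_image c3) = path_image c3"
      using disj ends[OF c3(2,3)] by blast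
    then show "Topological_Spaces.connected ((path_image c1 \<union> path_image c3) \<inter> (path_image c2 \<union> path_image c3))"
      using c3 by (simp add: connected_arc_image)
    show "connected_component (- (path_image c1 \<union> path_image c3)) x y"
      by (rule join[OF c1 c2 disj(1,3) touch(2) refl])
    show "connected_component (- (path_image c2 \<union> path_image c3)) x y"
      by (rule join[OF c2 c1 disj(1)[unfolded Int_commute[of "path_image c1"]] disj(2) touch(1) Un_commute])
  qed
  then have "connected_component (- (path_image c1 \<union> path_image c2)) x y"
    by (rule connected_component_of_subset) auto
  then show False using M(6)[OF x, of y] y by simp
qed

subsection \<open>Nonseparating ears\<close>

text \<open>The empty set counts as connected, unlike for
  \<open>Digraph_Component.connected\<close>: the final subdivision may use up all vertices.\<close>

definition connected_on :: "'a rel \<Rightarrow> 'a set \<Rightarrow> bool" where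
  "connected_on E S \<longleftrightarrow> (\<forall>x\<in>S. \<forall>y\<in>S. (x, y) \<in> rtrancl_on S E)"

definition nbrs :: "'a rel \<Rightarrow> 'a set \<Rightarrow> 'a set" where
  "nbrs E S = E `` S - S"

abbreviation walk :: "'a rel \<Rightarrow> 'a list \<Rightarrow> bool" where
  "walk E \<equiv> successively (\<lambda>x y. (x, y) \<in> E)"

lemma connected_on_empty [simp]: "connected_on E {}"
  by (simp add: connected_on_def)

lemma connected_on_singleton [simp]: "connected_on E {x}"
  by (simp add: connected_on_def)

lemma connected_on_Un:
  assumes "sym E" "connected_on E S" "connected_on E T" "s \<in> S" "t \<in> T" "(s, t) \<in> E"
  shows "connected_on E (S \<union> T)"
proof -
  let ?r = "rtrancl_on (S \<union> T) E"
  have S: "(x, y) \<in> ?r" if "x \<in> S" "y \<in> S" for x y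
    using assms(2) that by (auto simp: connected_on_def intro: rtrancl_on_mono[OF subset_refl Un_upper1])
  have T: "(x, y) \<in> ?r" if "x \<in> T" "y \<in> T" for x y
    using assms(3) that by (auto simp: connected_on_def intro: rtrancl_on_mono[OF subset_refl Un_upper2])
  have st: "(s, t) \<in> ?r" "(t, s) \<in> ?r"
    using assms by (auto dest: symD intro: rtrancl_on_into_rtrancl_on[OF rtrancl_on_refl])
  have S': "(x, t) \<in> ?r" "(t, x) \<in> ?r" if "x \<in> S" for x
    using S[OF that assms(4)] S[OF assms(4) that] st by (auto intro: rtrancl_on_trans)
  have "(x, t) \<in> ?r \<and> (t, x) \<in> ?r" if "x \<in> S \<union> T" for x
    using that S' T[OF _ assms(5)] T[OF assms(5)] by auto
  then show ?thesis
    unfolding connected_on_def by (blast intro: rtrancl_on_trans)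
qed

lemma connected_on_insert:
  assumes "sym E" "connected_on E S" "s \<in> S" "(s, v) \<in> E"
  shows "connected_on E (insert v S)"
  using connected_on_Un[OF assms(1,2) connected_on_singleton assms(3) _ assms(4)] by simp

text \<open>A walk inside \<open>S\<close> from a vertex of \<open>B\<close> to one outside has an
  arc on which it leaves \<open>B\<close>.\<close>

lemma connected_on_exit:
  assumes "connected_on E S" "B \<subseteq> S" "B \<noteq> {}" "B \<noteq> S"
  obtains u v where "u \<in> B" "v \<in> S - B" "(u, v) \<in> E"
proof -
  obtain x y where xy: "x \<in> B" "y \<in> S" "y \<notin> B"
    using assms by auto
  then have "(x, y) \<in> rtrancl_on S E"
    using assms by (auto simp: connected_on_def)
  then have "y \<in> B \<or> (\<exists>u\<in>B. \<exists>v\<in>S - B. (u, v) \<in> E)"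
    by (induct rule: rtrancl_on_induct) (use xy in auto)
  then show thesis using xy that by blast
qed

lemma connected_on_walk:
  assumes "sym E" "walk E xs"
  shows "connected_on E (set xs)"
  using assms(2)
proof (induction xs)
  case (Cons x xs)
  show ?case
  proof (cases xs)
    case (Cons y ys)
    then have "connected_on E (set xs)" "(y, x) \<in> E" "y \<in> set xs"
      using Cons.IH Cons.prems assms(1) by (auto dest: symD)
    then show ?thesis
      using connected_on_insert[OF assms(1)] by simp
  qed simp
qed simp

lemma connected_on_walkE:
  assumes "connected_on E S" "x \<in> S" "y \<in> S"
  obtains xs where "walk E xs" "distinct xs" "set xs \<subseteq> S" "xs \<noteq> []" "hd xs = x" "last xs = y"
proof -
  have "(x, y) \<in> rtrancl_on S E" using assms by (auto simp: connected_on_def)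
  then have "\<exists>xs. walk E xs \<and> distinct xs \<and> set xs \<subseteq> S \<and> xs \<noteq> [] \<and> hd xs = x \<and> last xs = y"
  proof (induct rule: rtrancl_on_induct)
    case base
    then show ?case by (intro exI[of _ "[x]"]) auto
  next
    case (step y z)
    then obtain xs where xs: "walk E xs" "distinct xs" "set xs \<subseteq> S" "xs \<noteq> []" "hd xs = x" "last xs = y"
      by auto
    show ?case
    proof (cases "z \<in> set xs")
      case True
      then obtain us vs where "xs = us @ z # vs" by (auto dest: split_list)
      then show ?thesis
        using xs by (intro exI[of _ "us @ [z]"]) (auto simp: successively_append_iff successively_Cons hd_append)
    next
      case False
      then show ?thesis
        using xs step by (intro exI[of _ "xs @ [z]"]) (auto simp: successively_append_iff)
    qed
  qed
  then show thesis using that by blast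
qed

text \<open>\<open>B\<close> is the set of vertices reachable from \<open>x\<close> inside
  \<open>S\<close>. It is connected in itself, because a walk from \<open>x\<close> meets only
  vertices that are reachable as well, and walks can be reversed.\<close>

lemma componentE:
  assumes "sym E" "x \<in> S"
  obtains B where "x \<in> B" "B \<subseteq> S" "connected_on E B" "E `` B \<inter> S \<subseteq> B"
proof
  let ?B = "{y. (x, y) \<in> rtrancl_on S E}"
  show "x \<in> ?B" using assms by simp
  show "?B \<subseteq> S" by (auto dest: in_rtrancl_on_in_F)
  show "E `` ?B \<inter> S \<subseteq> ?B" by (auto intro: rtrancl_on_into_rtrancl_on)
  have "(x, y) \<in> rtrancl_on ?B E" if "(x, y) \<in> rtrancl_on S E" for y
    using that
  proof (induct rule: rtrancl_on_induct)
    case (step y z)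
    then show ?case by (auto intro!: rtrancl_on_into_rtrancl_on[of x y] intro: rtrancl_on_into_rtrancl_on)
  qed (use assms in auto)
  moreover have "sym (rtrancl_on ?B E)"
    using assms by (rule_tac rtrancl_on_sym)
  ultimately show "connected_on E ?B"
    unfolding connected_on_def by (blast intro: rtrancl_on_trans dest: symD)
qed

text \<open>\<open>p\<close> and \<open>r\<close> are the first and the last entry of
  \<open>xs\<close> that belong to \<open>P\<close>, so all other elements of \<open>P\<close> occur
  between them.\<close>

lemma split_list_first_last:
  assumes "P \<subseteq> set xs" "finite P" "card P \<ge> 2"
  obtains us p vs r ws where "xs = us @ p # vs @ r # ws" "p \<in> P" "r \<in> P" "P \<subseteq> insert p (insert r (set vs))"
proof -
  obtain p q where "p \<in> P" "q \<in> P" "p \<noteq> q"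
    using assms by (metis card_2_iff' card_le_Suc0_iff_eq not_less_eq_eq numeral_2_eq_2)
  then have "\<exists>x\<in>set xs. x \<in> P" using assms by auto
  then obtain us p' ys where 1: "xs = us @ p' # ys" "p' \<in> P" "\<forall>u\<in>set us. u \<notin> P"
    using split_list_first_prop[of xs "\<lambda>x. x \<in> P"] by blast
  have "\<exists>x\<in>set ys. x \<in> P"
  proof (rule ccontr)
    assume "\<not> ?thesis"
    then have "P \<subseteq> {p'}" using 1 assms by auto
    then show False using \<open>p \<in> P\<close> \<open>q \<in> P\<close> \<open>p \<noteq> q\<close> by auto
  qed
  then obtain vs r ws where 2: "ys = vs @ r # ws" "r \<in> P" "\<forall>u\<in>set ws. u \<notin> P"
    using split_list_last_prop[of ys "\<lambda>x. x \<in> P"] by blast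
  show thesis
    by (rule that[of us p' vs r ws]) (use 1 2 assms in auto)
qed

locale simple_graph =
  fixes V :: "'a set" and E :: "'a rel"
  assumes finite_V: "finite V" and E_subset: "E \<subseteq> V \<times> V" and sym_E: "sym E"
begin

lemma adj_sym: "(x, y) \<in> E \<Longrightarrow> (y, x) \<in> E"
  using sym_E by (rule symD)

lemma nbrs_subset: "nbrs E S \<subseteq> V"
  using E_subset by (auto simp: nbrs_def)

text \<open>The list holds the inner vertices only, so \<open>set xs\<close> is exactly what the ear
  takes from \<open>V - W\<close>. Since it is nonempty, adding an ear always makes the rest
  smaller.\<close>

definition ear :: "'a set \<Rightarrow> 'a \<Rightarrow> 'a list \<Rightarrow> 'a \<Rightarrow> bool" where
  "ear W a xs b \<longleftrightarrow> xs \<noteq> [] \<and> distinct xs \<and> walk E xs \<and> set xs \<subseteq> V - W \<and>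
     a \<in> W \<and> b \<in> W \<and> a \<noteq> b \<and> (a, hd xs) \<in> E \<and> (last xs, b) \<in> E"

lemma ear_in_connected:
  assumes "connected_on E B" "B \<subseteq> V - W" "a \<in> W" "b \<in> W" "a \<noteq> b" "a \<in> nbrs E B" "b \<in> nbrs E B"
  shows "\<exists>a b xs. ear W a xs b \<and> set xs \<subseteq> B"
proof -
  obtain u v where "u \<in> B" "v \<in> B" "(a, u) \<in> E" "(v, b) \<in> E"
    using assms by (auto simp: nbrs_def intro: adj_sym)
  moreover obtain xs where "walk E xs" "distinct xs" "set xs \<subseteq> B" "xs \<noteq> []" "hd xs = u" "last xs = v"
    using connected_on_walkE[OF assms(1)] calculation by metis
  ultimately have "ear W a xs b \<and> set xs \<subseteq> B"
    using assms by (auto simp: ear_def)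
  then show ?thesis by blast
qed

end

locale three_connected_graph = simple_graph +
  assumes card_V: "card V > 3"
    and three_connected: "\<And>X. X \<subseteq> V \<Longrightarrow> card X \<le> 2 \<Longrightarrow> connected_on E (V - X)"
begin

text \<open>If a vertex lay outside \<open>B\<close> and \<open>X\<close>, deleting the at most two
  vertices of \<open>X - B\<close> would leave it connected to \<open>B\<close>, and an edge would
  leave \<open>B\<close> without ending in \<open>X\<close>.\<close>

lemma small_boundary:
  assumes "B \<subseteq> V" "B \<noteq> {}" "nbrs E B \<subseteq> X" "X \<subseteq> V" "card X \<le> 2"
  shows "V \<subseteq> B \<union> X"
proof (rule ccontr)
  assume "\<not> ?thesis"
  then have "B \<noteq> V - (X - B)" by blast
  moreover have "finite X" using assms(4) finite_V finite_subset by blast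
  then have "card (X - B) \<le> 2"
    using assms(5) card_mono[of X "X - B"] by auto
  then have "connected_on E (V - (X - B))"
    using assms(4) by (intro three_connected) auto
  ultimately obtain u v where "u \<in> B" "v \<in> V - (X - B) - B" "(u, v) \<in> E"
    using connected_on_exit[of E "V - (X - B)" B] assms(1,2) by blast
  then show False using assms(3) by (auto simp: nbrs_def)
qed

text \<open>
  Let \<open>K\<close> be a largest connected part of the rest whose removal still leaves an ear. By maximality
  every such ear contains all vertices that touch \<open>K\<close>. A component \<open>B\<close> of what remains has at least
  three neighbours, so an ear can be routed through \<open>B\<close> past one of these vertices.
\<close>

lemma nonseparating_ear:
  assumes W: "W \<subseteq> V" "card W \<ge> 2" and R: "connected_on E (V - W)" "V - W \<noteq> {}"
  obtains a xs b where "ear W a xs b" "connected_on E (V - W - set xs)"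
proof -
  define P where "P K \<longleftrightarrow> K \<subseteq> V - W \<and> connected_on E K \<and>
    (\<exists>a xs b. ear W a xs b \<and> set xs \<subseteq> V - W - K)" for K
  \<comment> \<open>For the start with empty \<open>K\<close>: if the rest had fewer than two
    neighbours, \<open>small_boundary\<close> would put all of \<open>W\<close> among them.\<close>
  have "card (nbrs E (V - W)) \<ge> 2"
  proof (rule ccontr)
    assume less: "\<not> ?thesis"
    have sub: "nbrs E (V - W) \<subseteq> W" using E_subset by (auto simp: nbrs_def)
    have "V \<subseteq> (V - W) \<union> nbrs E (V - W)"
      using less R nbrs_subset by (intro small_boundary) auto
    then have "W \<subseteq> nbrs E (V - W)" using W by auto
    then show False using less sub W by (metis subset_antisym)
  qed
  then obtain a b where "a \<in> nbrs E (V - W)" "b \<in> nbrs E (V - W)" "a \<noteq> b"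
    by (metis card_le_Suc0_iff_eq finite_subset[OF nbrs_subset finite_V] not_less_eq_eq numeral_2_eq_2)
  moreover have "a \<in> W" "b \<in> W" using calculation nbrs_subset[of "V - W"] by (auto simp: nbrs_def)
  ultimately have "\<exists>a b xs. ear W a xs b \<and> set xs \<subseteq> V - W"
    using ear_in_connected[of "V - W" W a b] R(1) by blast
  then have "P {}"
    unfolding P_def by auto
  moreover have "\<forall>K. P K \<longrightarrow> card K \<le> card V"
    using finite_V by (auto simp: P_def intro: card_mono)
  ultimately obtain K where PK: "P K" and max: "\<And>K'. P K' \<Longrightarrow> card K' \<le> card K"
    using ex_has_greatest_nat[of P "{}" card "Suc (card V)"] by (auto simp: less_Suc_eq_le)
  define L where "L = V - W - K"
  \<comment> \<open>These are the vertices that can be added to \<open>K\<close> without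
    disconnecting it. For empty \<open>K\<close> they are all of \<open>L\<close>, so a vertex of
    \<open>L - X\<close> shows that \<open>K\<close> is nonempty.\<close>
  define X where "X = {v \<in> L. connected_on E (insert v K)}"
  have K: "K \<subseteq> V - W" "connected_on E K" "finite K"
    using PK finite_V by (auto simp: P_def intro: finite_subset)
  have X_sub: "X \<subseteq> set xs" if "ear W a xs b" "set xs \<subseteq> L" for a xs b
  proof (rule ccontr)
    assume "\<not> ?thesis"
    then obtain v where v: "v \<in> X" "v \<notin> set xs" by auto
    then have "P (insert v K)"
      using that K unfolding P_def X_def L_def by blast
    then have "card (insert v K) \<le> card K" by (rule max)
    then show False using v K by (auto simp: X_def L_def)
  qed
  obtain a xs b where xs: "ear W a xs b" "set xs \<subseteq> L"
    using PK by (auto simp: P_def L_def)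
  \<comment> \<open>This suffices: by \<open>X_sub\<close> the ear then covers all of
    \<open>L\<close>, and its removal leaves exactly the connected set \<open>K\<close>.\<close>
  have "L \<subseteq> X"
  proof (rule ccontr)
    assume "\<not> ?thesis"
    then obtain v where v: "v \<in> L" "v \<notin> X" by auto
    have Kne: "K \<noteq> {}" using v by (auto simp: X_def)
    have adjX: "y \<in> X" if "x \<in> K" "(x, y) \<in> E" "y \<in> L" for x y
      using that connected_on_insert[OF sym_E K(2)] by (auto simp: X_def)
    have "K \<noteq> V - W" using xs by (auto simp: L_def ear_def)
    then obtain u y where "u \<in> K" "y \<in> V - W - K" "(u, y) \<in> E"
      using connected_on_exit[OF R(1) K(1) Kne] by blast
    then obtain y where y: "y \<in> X" using adjX by (auto simp: L_def)
    obtain B where B: "v \<in> B" "B \<subseteq> L - X" "connected_on E B" "E `` B \<inter> (L - X) \<subseteq> B"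
      using componentE[OF sym_E, of v "L - X"] v by auto
    let ?N = "nbrs E B"
    have finN: "finite ?N" using finite_subset[OF nbrs_subset finite_V] .
    have BV: "B \<subseteq> V - W" using B by (auto simp: L_def)
    have NB: "?N \<subseteq> X \<union> W"
    proof
      fix z assume z: "z \<in> ?N"
      then obtain u where u: "u \<in> B" "(u, z) \<in> E" "z \<notin> B" by (auto simp: nbrs_def)
      have "z \<in> V" using z nbrs_subset by auto
      have "z \<notin> K" using u B adjX[of z u] adj_sym by auto
      then show "z \<in> X \<union> W" using \<open>z \<in> V\<close> u B by (auto simp: L_def)
    qed
    \<comment> \<open>Otherwise \<open>B\<close> and its boundary would cover \<open>V\<close>,
      although the nonempty \<open>K\<close> meets neither.\<close>
    have "card ?N \<ge> 3"
    proof (rule ccontr)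
      assume "\<not> ?thesis"
      then have "V \<subseteq> B \<union> ?N"
        using B BV nbrs_subset by (intro small_boundary) auto
      moreover have "K \<subseteq> V" "K \<inter> B = {}" "K \<inter> ?N = {}"
        using K B NB by (auto simp: L_def X_def)
      ultimately show False using Kne by blast
    qed
    \<comment> \<open>An ear routed through such a \<open>C\<close> would avoid \<open>K\<close> and
      also miss \<open>x\<close>, against \<open>X_sub\<close>. The rest of the argument looks for a
      suitable \<open>C\<close>.\<close>
    have skip: False
      if C: "connected_on E C" "C \<subseteq> L" "c \<in> W" "d \<in> W" "c \<noteq> d" "c \<in> nbrs E C" "d \<in> nbrs E C" "x \<in> X" "x \<notin> C"
      for C c d x
    proof -
      obtain a' b' xs' where "ear W a' xs' b'" "set xs' \<subseteq> C"
        using ear_in_connected[OF C(1) _ C(3-7)] C(2) unfolding L_def by blast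
      then show False using X_sub[of a' xs' b'] C(2,8,9) by blast
    qed
    have split: "?N = (?N \<inter> X) \<union> (?N \<inter> W)" "(?N \<inter> X) \<inter> (?N \<inter> W) = {}"
      using NB by (auto simp: X_def L_def)
    have card_N: "card ?N = card (?N \<inter> X) + card (?N \<inter> W)"
      using card_Un_disjoint[OF _ _ split(2)] finN split(1) by auto
    have Xxs: "?N \<inter> X \<subseteq> set xs" using X_sub[OF xs] by auto
    have dist: "distinct xs" "walk E xs" and ab: "a \<in> W" "b \<in> W" "a \<noteq> b" "(a, hd xs) \<in> E" "(last xs, b) \<in> E"
      using xs by (auto simp: ear_def)
    have NW1: "card (?N \<inter> W) \<le> 1"
    proof (rule ccontr)
      assume "\<not> ?thesis"
      then obtain c d where "c \<in> ?N \<inter> W" "d \<in> ?N \<inter> W" "c \<noteq> d"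
        by (metis card_le_Suc0_iff_eq finite_Int[OF disjI1, OF finN] One_nat_def)
      then show False using skip[of B c d y] B y by auto
    qed
    then have "card (?N \<inter> X) \<ge> 2" using card_N \<open>card ?N \<ge> 3\<close> by auto
    then obtain us p vs r ws where sp: "xs = us @ p # vs @ r # ws" "p \<in> ?N \<inter> X" "r \<in> ?N \<inter> X"
      "?N \<inter> X \<subseteq> insert p (insert r (set vs))"
      using split_list_first_last[OF Xxs] finN by (metis finite_Int)
    have pr: "p \<in> X" "r \<in> X" "p \<notin> B" "r \<notin> B" using sp B by auto
    obtain p' r' where pr': "p' \<in> B" "(p', p) \<in> E" "r' \<in> B" "(r', r) \<in> E"
      using sp by (auto simp: nbrs_def)
    \<comment> \<open>\<open>?l\<close> is the part of the ear up to \<open>p\<close> and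
      \<open>?r\<close> the part from \<open>r\<close> on; each is joined to \<open>B\<close> by an
      edge.\<close>
    let ?l = "set (us @ [p])" and ?r = "set (r # ws)"
    have sub: "?l \<subseteq> L" "?r \<subseteq> L" using xs sp by auto
    have l: "connected_on E ?l" and r: "connected_on E ?r"
      using dist sp by (auto intro!: connected_on_walk[OF sym_E] simp: successively_append_iff successively_Cons
          simp del: set_append set_simps)
    have Bl: "connected_on E (B \<union> ?l)"
      by (rule connected_on_Un[OF sym_E B(3) l pr'(1) _ pr'(2)]) simp
    have Br: "connected_on E (B \<union> ?r)"
      by (rule connected_on_Un[OF sym_E B(3) r pr'(3) _ pr'(4)]) simp
    have Blr: "connected_on E (B \<union> ?l \<union> ?r)"
      by (rule connected_on_Un[OF sym_E Bl r _ _ pr'(4)]) (use pr' in auto)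
    have a_nb: "a \<in> nbrs E C" if "?l \<subseteq> C" "C \<subseteq> L" for C
    proof -
      have "hd xs \<in> ?l" using sp by (cases us) auto
      then have "hd xs \<in> C" "(hd xs, a) \<in> E" using ab that adj_sym by auto
      then show ?thesis using ab that unfolding nbrs_def L_def by blast
    qed
    have b_nb: "b \<in> nbrs E C" if "?r \<subseteq> C" "C \<subseteq> L" for C
    proof -
      have "last xs \<in> ?r" using sp by auto
      then show ?thesis using ab that unfolding nbrs_def L_def by blast
    qed
    have BL: "B \<subseteq> L" using B by auto
    \<comment> \<open>If \<open>B\<close> has no neighbour in \<open>W\<close>, it has a third
      neighbour \<open>q\<close> in \<open>X\<close>, strictly between \<open>p\<close> and
      \<open>r\<close> on the ear; the detour from \<open>a\<close> through \<open>B\<close> to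
      \<open>b\<close> misses \<open>q\<close>. Otherwise a neighbour \<open>w\<close> in
      \<open>W\<close> replaces one end of the ear: the route from \<open>w\<close> through
      \<open>B\<close> to \<open>b\<close> misses \<open>p\<close>, and if \<open>w = b\<close>, the
      route from \<open>a\<close> through \<open>B\<close> to \<open>b\<close> misses
      \<open>r\<close>.\<close>
    show False
    proof (cases "?N \<inter> W = {}")
      case True
      then have "card (?N \<inter> X) \<ge> 3" using card_N \<open>card ?N \<ge> 3\<close> by auto
      moreover have "card {p, r} \<le> 2" by (simp add: card_insert_if)
      ultimately have "\<not> ?N \<inter> X \<subseteq> {p, r}" using card_mono[of "{p, r}" "?N \<inter> X"] by auto
      then obtain q where q: "q \<in> ?N \<inter> X" "q \<in> set vs" using sp by blast
      have "q \<notin> B \<union> ?l \<union> ?r" using q dist sp B by auto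
      then show False
        using skip[OF Blr, of a b q] ab q a_nb[of "B \<union> ?l \<union> ?r"] b_nb[of "B \<union> ?l \<union> ?r"] BL sub by blast
    next
      case False
      then obtain w where w: "w \<in> ?N" "w \<in> W" by auto
      have w_nb: "w \<in> nbrs E C" if "B \<subseteq> C" "C \<subseteq> L" for C
        using w that by (auto simp: nbrs_def L_def)
      show False
      proof (cases "w = b")
        case False
        have "p \<notin> B \<union> ?r" using dist sp pr by auto
        then show False
          using skip[OF Br, of w b p] w ab pr False w_nb[of "B \<union> ?r"] b_nb[of "B \<union> ?r"] BL sub by blast
      next
        case True
        have "r \<notin> B \<union> ?l" using dist sp pr by auto
        then show False
          using skip[OF Bl, of w a r] w ab pr True w_nb[of "B \<union> ?l"] a_nb[of "B \<union> ?l"] BL sub by blast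
      qed
    qed
  qed
  then have "set xs = L" using X_sub[OF xs] xs by auto
  then have "V - W - set xs = K" using K by (auto simp: L_def)
  then show thesis using that[OF xs(1)] K by simp
qed

end

subsection \<open>Spanning subdivisions of $K_4$\<close>

text \<open>The branch vertices \<open>a\<close>, \<open>b\<close>, \<open>c\<close>,
  \<open>d\<close> lie in this order on a cycle formed by the \<open>P\<close> paths;
  \<open>Q1\<close> and \<open>Q2\<close> are the diagonals. Lists hold inner vertices, and an empty
  list is an undivided edge.\<close>

definition K4_on :: "'a rel \<Rightarrow> 'a set \<Rightarrow> bool" where
  "K4_on E S \<longleftrightarrow> (\<exists>a b c d P1 P2 P3 P4 Q1 Q2.
     distinct (a # b # c # d # P1 @ P2 @ P3 @ P4 @ Q1 @ Q2) \<and>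
     S = set (a # b # c # d # P1 @ P2 @ P3 @ P4 @ Q1 @ Q2) \<and>
     walk E (a # P1 @ [b]) \<and> walk E (b # P2 @ [c]) \<and> walk E (c # P3 @ [d]) \<and> walk E (d # P4 @ [a]) \<and>
     walk E (a # Q1 @ [c]) \<and> walk E (b # Q2 @ [d]))"

lemma K4_onI:
  assumes "distinct (a # b # c # d # P1 @ P2 @ P3 @ P4 @ Q1 @ Q2)"
    and "S = set (a # b # c # d # P1 @ P2 @ P3 @ P4 @ Q1 @ Q2)"
    and "walk E (a # P1 @ [b])" "walk E (b # P2 @ [c])" "walk E (c # P3 @ [d])" "walk E (d # P4 @ [a])"
    and "walk E (a # Q1 @ [c])" "walk E (b # Q2 @ [d])"
  shows "K4_on E S"
  unfolding K4_on_def using assms by blast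

lemma walk_append_Cons: "walk E (us @ x # vs) \<longleftrightarrow> walk E (us @ [x]) \<and> walk E (x # vs)"
  by (auto simp: successively_append_iff)

context simple_graph
begin

text \<open>Length 2 is allowed, so that a single edge counts as a degenerate cycle from which the
  growth can start.\<close>

definition cycle_list :: "'a list \<Rightarrow> bool" where
  "cycle_list zs \<longleftrightarrow> length zs \<ge> 2 \<and> distinct zs \<and> set zs \<subseteq> V \<and> walk E zs \<and> (last zs, hd zs) \<in> E"

lemma walk_rev: "walk E (rev xs) \<longleftrightarrow> walk E xs"
  using adj_sym by (auto elim!: successively_mono)

lemma cycle_list_rotate:
  assumes "cycle_list (us @ vs)"
  shows "cycle_list (vs @ us)"
  using assms by (cases "us = []"; cases "vs = []")
    (auto simp: cycle_list_def successively_append_iff)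

lemma cycle_list_split:
  assumes "cycle_list (a # xs @ b # ys)"
  shows "walk E (a # xs @ [b])" "walk E (b # ys @ [a])"
  using assms walk_append_Cons[of E "a # xs" b ys]
  by (auto simp: cycle_list_def successively_append_iff[of _ "b # ys" "[a]"] simp flip: append_Cons)

text \<open>The vertices \<open>a\<close>, \<open>s\<close>, \<open>b\<close>, \<open>t\<close>
  occur in this order around the cycle and become the branch vertices; \<open>qs\<close> and the
  edge from \<open>s\<close> to \<open>t\<close> are the diagonals. The list \<open>qs\<close> may
  be empty, which covers a chord from \<open>a\<close> to \<open>b\<close>.\<close>

lemma K4_on_crossing_chords:
  assumes zs: "cycle_list (a # xs @ b # ys)" and st: "s \<in> set xs" "t \<in> set ys" "(s, t) \<in> E"
    and Q: "walk E (a # qs @ [b])" "distinct qs" "set qs \<inter> set (a # xs @ b # ys) = {}"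
  shows "K4_on E (set (a # xs @ b # ys) \<union> set qs)"
proof -
  obtain x1 x2 y1 y2 where sp: "xs = x1 @ s # x2" "ys = y1 @ t # y2"
    using st by (meson split_list)
  have w: "walk E (a # xs @ [b])" "walk E (b # ys @ [a])" and d: "distinct (a # xs @ b # ys)"
    using cycle_list_split[OF zs] zs by (auto simp: cycle_list_def)
  have "walk E (a # x1 @ [s])" "walk E (s # x2 @ [b])" "walk E (b # y1 @ [t])" "walk E (t # y2 @ [a])"
    using w walk_append_Cons[of E "a # x1" s "x2 @ [b]"] walk_append_Cons[of E "b # y1" t "y2 @ [a]"]
    unfolding sp by simp_all
  moreover have "distinct (a # s # b # t # x1 @ x2 @ y1 @ y2 @ qs @ [])"
    using d Q unfolding sp by auto
  moreover have "set (a # xs @ b # ys) \<union> set qs = set (a # s # b # t # x1 @ x2 @ y1 @ y2 @ qs @ [])"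
    unfolding sp by auto
  ultimately show ?thesis
    using K4_onI[of a s b t x1 x2 y1 y2 qs "[]"] Q st by simp
qed

text \<open>Cycle and ear form three paths between \<open>a\<close> and \<open>b\<close>. An edge
  joining inner vertices \<open>s\<close> and \<open>t\<close> of two of them gives a $K_4$ with
  branch vertices \<open>a\<close>, \<open>b\<close>, \<open>s\<close>, \<open>t\<close>.\<close>

lemma K4_on_third_attachment:
  assumes zs: "cycle_list (a # xs @ b # ys)" and st: "s \<in> set qs" "t \<in> set xs" "(s, t) \<in> E"
    and Q: "walk E (a # qs @ [b])" "distinct qs" "set qs \<inter> set (a # xs @ b # ys) = {}"
  shows "K4_on E (set (a # xs @ b # ys) \<union> set qs)"
proof -
  obtain x1 x2 q1 q2 where sp: "xs = x1 @ t # x2" "qs = q1 @ s # q2"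
    using st by (meson split_list)
  have w: "walk E (a # xs @ [b])" "walk E (b # ys @ [a])" and d: "distinct (a # xs @ b # ys)"
    using cycle_list_split[OF zs] zs by (auto simp: cycle_list_def)
  have "walk E (a # q1 @ [s])" "walk E (t # x2 @ [b])" "walk E (a # x1 @ [t])" "walk E (s # q2 @ [b])"
    using w Q walk_append_Cons[of E "a # x1" t "x2 @ [b]"] walk_append_Cons[of E "a # q1" s "q2 @ [b]"]
    unfolding sp by simp_all
  moreover have "distinct (a # s # t # b # q1 @ [] @ x2 @ ys @ x1 @ q2)"
    using d Q unfolding sp by auto
  moreover have "set (a # xs @ b # ys) \<union> set qs = set (a # s # t # b # q1 @ [] @ x2 @ ys @ x1 @ q2)"
    unfolding sp by auto
  ultimately show ?thesis
    using K4_onI[of a s t b q1 "[]" x2 ys x1 q2] w st by simp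
qed

end

text \<open>
  \<open>no_K33\<close> excludes a subdivision of $K_{3,3}$ with one branch vertex blown up to the connected set \<open>R\<close>.
\<close>

locale three_connected_K33_free = three_connected_graph +
  assumes no_K33: "\<And>a b P Q S R. \<lbrakk>distinct (a # b # P @ Q @ S); walk E (a # P @ [b]); walk E (a # Q @ [b]);
    walk E (a # S @ [b]); connected_on E R; R \<subseteq> V; R \<inter> set (a # b # P @ Q @ S) = {};
    nbrs E R \<inter> set P \<noteq> {}; nbrs E R \<inter> set Q \<noteq> {}; nbrs E R \<inter> set S \<noteq> {}\<rbrakk> \<Longrightarrow> False"
begin

text \<open>Without these edges the boundary of \<open>xs\<close> is contained in
  \<open>{a, b}\<close>, so \<open>a\<close> and \<open>b\<close> would separate \<open>xs\<close>
  from the nonempty \<open>ys\<close>.\<close>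

lemma cycle_chord_boundary:
  assumes zs: "cycle_list (a # xs @ b # ys)" and ne: "xs \<noteq> []" "ys \<noteq> []"
    and "\<And>s t. s \<in> set xs \<Longrightarrow> t \<in> set ys \<Longrightarrow> (s, t) \<notin> E"
    and "\<And>s t. s \<in> set xs \<Longrightarrow> t \<in> V - set (a # xs @ b # ys) \<Longrightarrow> (s, t) \<notin> E"
  shows False
proof -
  have sub: "set (a # xs @ b # ys) \<subseteq> V" and d: "distinct (a # xs @ b # ys)"
    using zs by (auto simp: cycle_list_def)
  have "nbrs E (set xs) \<subseteq> {a, b}"
  proof
    fix t assume t: "t \<in> nbrs E (set xs)"
    then obtain s where "s \<in> set xs" "(s, t) \<in> E" "t \<notin> set xs" by (auto simp: nbrs_def)
    moreover have "t \<in> V" using t nbrs_subset by auto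
    ultimately show "t \<in> {a, b}" using assms(4,5)[of s t] by auto
  qed
  then have "V \<subseteq> set xs \<union> {a, b}"
    using sub ne by (intro small_boundary) (auto simp: card_insert_if)
  then have "set ys \<subseteq> set xs \<union> {a, b}" using sub by auto
  then show False using ne d by (cases ys) auto
qed

text \<open>When nothing is left there is no ear, but a chord does its work: \<open>x\<close> has a
  neighbour \<open>b\<close> other than its two cycle neighbours \<open>y\<close> and
  \<open>l\<close>, and by \<open>cycle_chord_boundary\<close> some edge crosses the chord from
  \<open>x\<close> to \<open>b\<close>.\<close>

lemma K4_on_hamiltonian:
  assumes zs: "cycle_list zs" "set zs = V"
  shows "K4_on E V"
proof -
  have d: "distinct zs" "length zs = card V" using zs distinct_card[of zs] by (auto simp: cycle_list_def)
  then obtain x y us where us: "zs = x # y # us" "us \<noteq> []"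
    using card_V by (cases zs; cases "tl zs"; cases "tl (tl zs)") auto
  define l where "l = last us"
  obtain ws where ws: "us = ws @ [l]" using us by (metis l_def append_butlast_last_id)
  have "\<not> nbrs E {x} \<subseteq> {y, l}"
  proof
    assume "nbrs E {x} \<subseteq> {y, l}"
    then have "V \<subseteq> {x} \<union> {y, l}"
      using zs us ws by (intro small_boundary) (auto simp: card_insert_if)
    then have "card V \<le> card {x, y, l}" by (intro card_mono) auto
    then show False using card_V by (auto simp: card_insert_if split: if_splits)
  qed
  then obtain b where b: "b \<in> nbrs E {x}" "b \<noteq> y" "b \<noteq> l" by auto
  then have "b \<in> set ws" "(x, b) \<in> E"
    using nbrs_subset[of "{x}"] zs us ws by (auto simp: nbrs_def)
  then obtain w1 w2 where w: "ws = w1 @ b # w2" by (meson split_list)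
  have zs_eq: "zs = x # (y # w1) @ b # (w2 @ [l])" using us ws w by simp
  have cyc: "cycle_list (x # (y # w1) @ b # (w2 @ [l]))" using zs(1) zs_eq by simp
  obtain s t where st: "s \<in> set (y # w1)" "t \<in> set (w2 @ [l])" "(s, t) \<in> E"
    using cycle_chord_boundary[OF cyc] zs(2) zs_eq by auto
  have "K4_on E (set (x # (y # w1) @ b # (w2 @ [l])) \<union> set [])"
    by (rule K4_on_crossing_chords[OF cyc st]) (use \<open>(x, b) \<in> E\<close> in auto)
  then show ?thesis using zs(2) zs_eq by simp
qed

text \<open>The ear takes the place of the empty segment, reversed if that is the one from
  \<open>b\<close> back to \<open>a\<close>. This includes the first step, where both segments of a
  single edge are empty.\<close>

lemma cycle_list_extend:
  assumes zs: "cycle_list (a # xs @ b # ys)" and xs: "xs = [] \<or> ys = []"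
    and Q: "ear (set (a # xs @ b # ys)) a qs b"
  obtains zs' where "cycle_list zs'" "set zs' = set (a # xs @ b # ys) \<union> set qs"
proof -
  have q: "qs \<noteq> []" "distinct qs" "walk E qs" "set qs \<subseteq> V - set (a # xs @ b # ys)"
    "(a, hd qs) \<in> E" "(last qs, b) \<in> E" "(hd qs, a) \<in> E" "(b, last qs) \<in> E"
    using Q adj_sym by (auto simp: ear_def)
  from xs show thesis
  proof
    assume "xs = []"
    then show thesis
      using zs q by (intro that[of "a # qs @ b # ys"])
        (auto simp: cycle_list_def successively_append_iff successively_Cons split: if_splits)
  next
    assume "ys = []"
    moreover have "walk E (rev qs)" using q walk_rev by blast
    ultimately show thesis
      using zs q by (intro that[of "a # xs @ b # rev qs"])
        (auto simp: cycle_list_def successively_append_iff successively_Cons hd_rev last_rev hd_append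
          simp del: successively_rev split: if_splits)
  qed
qed

lemma K4_on_from_cycle:
  assumes "cycle_list zs" "connected_on E (V - set zs)"
  shows "\<exists>S\<subseteq>V. K4_on E S \<and> connected_on E (V - S)"
  using assms
proof (induction "card (V - set zs)" arbitrary: zs rule: less_induct)
  case less
  show ?case
  proof (cases "V - set zs = {}")
    case True
    then have "set zs = V" using less.prems by (auto simp: cycle_list_def)
    then show ?thesis using K4_on_hamiltonian less.prems by auto
  next
    case False
    have "card (set zs) \<ge> 2" "set zs \<subseteq> V"
      using less.prems distinct_card[of zs] by (auto simp: cycle_list_def)
    then obtain a qs b where Q: "ear (set zs) a qs b" and R: "connected_on E (V - set zs - set qs)"
      using nonseparating_ear[OF _ _ less.prems(2) False] by blast
    have q: "qs \<noteq> []" "distinct qs" "walk E qs" "set qs \<subseteq> V - set zs" "a \<in> set zs" "b \<in> set zs" "a \<noteq> b"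
      "(a, hd qs) \<in> E" "(last qs, b) \<in> E"
      using Q by (auto simp: ear_def)
    have wq: "walk E (a # qs @ [b])"
      using q by (auto simp: successively_append_iff successively_Cons)
    \<comment> \<open>Rotate the cycle so that it begins at \<open>a\<close>; then \<open>b\<close>
      cuts the remaining list into the segments \<open>xs\<close> and \<open>ys\<close>.\<close>
    obtain u1 u2 where "zs = u1 @ a # u2" using q by (meson split_list)
    then have cyc': "cycle_list ((a # u2) @ u1)" and set': "set zs = set ((a # u2) @ u1)"
      using less.prems(1) cycle_list_rotate[of u1 "a # u2"] by auto
    have "b \<in> set (u2 @ u1)" using set' q by auto
    then obtain xs ys where xy: "u2 @ u1 = xs @ b # ys" by (meson split_list)
    have cyc: "cycle_list (a # xs @ b # ys)" using cyc' xy by simp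
    have seteq: "set zs = set (a # xs @ b # ys)" using set' xy by (metis append_Cons list.simps(15))
    have Rest: "V - (set (a # xs @ b # ys) \<union> set qs) = V - set zs - set qs" using seteq by auto
    have SV: "set (a # xs @ b # ys) \<union> set qs \<subseteq> V"
      using cyc q by (auto simp: cycle_list_def)
    have qdisj: "set qs \<inter> set (a # xs @ b # ys) = {}" using q seteq by auto
    have found: ?thesis if "K4_on E (set (a # xs @ b # ys) \<union> set qs)"
      using that R Rest SV by metis
    show ?thesis
    proof (cases "xs = [] \<or> ys = []")
      case True
      obtain zs' where zs': "cycle_list zs'" "set zs' = set (a # xs @ b # ys) \<union> set qs"
        using cycle_list_extend[OF cyc True] Q seteq by auto
      have eq: "V - set zs' = V - set zs - set qs" unfolding zs'(2) by (rule Rest)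
      have "hd qs \<in> set qs" using q(1) by simp
      then have "V - set zs' \<subset> V - set zs" unfolding eq using q(4) by blast
      then have "card (V - set zs') < card (V - set zs)"
        using finite_V by (intro psubset_card_mono) auto
      then show ?thesis using less.hyps[OF _ zs'(1)] R unfolding eq by blast
    next
      case False
      then have ne: "xs \<noteq> []" "ys \<noteq> []" by auto
      \<comment> \<open>Read from \<open>b\<close>, and with the ear reversed, the same cycle has
        its two segments exchanged, so the lemmas about \<open>xs\<close> also apply to
        \<open>ys\<close>.\<close>
      have cyc2: "cycle_list (b # ys @ a # xs)"
        using cycle_list_rotate[of "a # xs" "b # ys"] cyc by simp
      have wq2: "walk E (b # rev qs @ [a])"
        using wq walk_rev[of "a # qs @ [b]"] by simp
      have eq2: "set (b # ys @ a # xs) \<union> set (rev qs) = set (a # xs @ b # ys) \<union> set qs" by auto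
      show ?thesis
      proof (rule ccontr)
        assume no: "\<not> ?thesis"
        have c1: "(s, t) \<notin> E" if "s \<in> set xs" "t \<in> set ys" for s t
          using K4_on_crossing_chords[OF cyc that _ wq q(2) qdisj] found no by blast
        have c2: "(s, t) \<notin> E" if "s \<in> set qs" "t \<in> set xs" for s t
          using K4_on_third_attachment[OF cyc that _ wq q(2) qdisj] found no by blast
        have c3: "(s, t) \<notin> E" if "s \<in> set qs" "t \<in> set ys" for s t
        proof
          assume "(s, t) \<in> E"
          then have "K4_on E (set (b # ys @ a # xs) \<union> set (rev qs))"
            using K4_on_third_attachment[OF cyc2 _ that(2) _ wq2, of s] that q(2) qdisj by auto
          then show False using found no unfolding eq2 by blast
        qed
        let ?R = "V - set zs - set qs"
        \<comment> \<open>Edges from \<open>xs\<close> to \<open>ys\<close> or to the ear are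
          excluded by \<open>c1\<close> and \<open>c2\<close>, so
          \<open>cycle_chord_boundary\<close> leaves only an edge to \<open>?R\<close>.\<close>
        have x: "nbrs E ?R \<inter> set xs \<noteq> {}"
        proof
          assume "nbrs E ?R \<inter> set xs = {}"
          then have "(s, t) \<notin> E" if "s \<in> set xs" "t \<in> ?R" for s t
            using that adj_sym[of s t] seteq unfolding nbrs_def by auto
          moreover have "(s, t) \<notin> E" if "s \<in> set xs" "t \<in> set qs" for s t
            using that c2 adj_sym by blast
          ultimately show False
            using cycle_chord_boundary[OF cyc ne c1] seteq by blast
        qed
        have y: "nbrs E ?R \<inter> set ys \<noteq> {}"
        proof
          assume "nbrs E ?R \<inter> set ys = {}"
          then have "(s, t) \<notin> E" if "s \<in> set ys" "t \<in> ?R" for s t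
            using that adj_sym[of s t] seteq unfolding nbrs_def by auto
          moreover have "(s, t) \<notin> E" if "s \<in> set ys" "t \<in> set qs" for s t
            using that c3 adj_sym by blast
          moreover have "(s, t) \<notin> E" if "s \<in> set ys" "t \<in> set xs" for s t
            using that c1 adj_sym by blast
          moreover have "V - set (b # ys @ a # xs) \<subseteq> ?R \<union> set qs" using seteq by auto
          ultimately show False
            using cycle_chord_boundary[OF cyc2 ne(2,1)] by blast
        qed
        \<comment> \<open>\<open>?R\<close> is a nonempty proper part of the connected set
          \<open>V - set zs\<close>, and an edge leaving it within that set ends on the ear.\<close>
        have "?R \<noteq> {}" using x by (auto simp: nbrs_def)
        moreover have "?R \<subseteq> V - set zs" "?R \<noteq> V - set zs" using q by (cases qs, auto)+
        ultimately obtain u v where uv: "u \<in> ?R" "v \<in> V - set zs - ?R" "(u, v) \<in> E"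
          using connected_on_exit[OF less.prems(2)] by blast
        then have z: "nbrs E ?R \<inter> set qs \<noteq> {}" by (auto simp: nbrs_def)
        \<comment> \<open>Reversed, \<open>ys\<close> also runs from \<open>a\<close> to
          \<open>b\<close>, which gives the third path for \<open>no_K33\<close>.\<close>
        have w: "walk E (a # xs @ [b])" "walk E (a # rev ys @ [b])"
          using cycle_list_split[OF cyc] walk_rev[of "b # ys @ [a]"] by auto
        have "distinct (a # b # qs @ xs @ rev ys)"
          using cyc qdisj q(2) by (auto simp: cycle_list_def)
        moreover have "?R \<inter> set (a # b # qs @ xs @ rev ys) = {}" using seteq by auto
        ultimately show False
          using no_K33[of a b qs xs "rev ys" ?R] wq w R x y z by auto
      qed
    qed
  qed
qed

text \<open>The growth starts at an edge, whose two ends do not separate the graph. An edge exists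
  because an isolated vertex would have an empty boundary.\<close>

lemma K4_on_nonseparating: "\<exists>S\<subseteq>V. K4_on E S \<and> connected_on E (V - S)"
proof -
  obtain x where x: "x \<in> V" using card_V by fastforce
  have "\<not> nbrs E {x} \<subseteq> {}"
  proof
    assume "nbrs E {x} \<subseteq> {}"
    then have "V \<subseteq> {x} \<union> {}" using x by (intro small_boundary) auto
    then have "card V \<le> card {x}" by (intro card_mono) auto
    then show False using card_V by simp
  qed
  then obtain y where y: "(x, y) \<in> E" "y \<noteq> x" "y \<in> V" using E_subset by (auto simp: nbrs_def)
  have "cycle_list [x, y]" using x y adj_sym by (auto simp: cycle_list_def)
  moreover have "connected_on E (V - set [x, y])"
    using x y by (intro three_connected) (auto simp: card_insert_if)
  ultimately show ?thesis by (rule K4_on_from_cycle)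
qed

end

section \<open>From systems of paths to subdivided digraphs\<close>

fun path_arcs :: "'a list \<Rightarrow> 'a rel" where
  "path_arcs (x # y # zs) = {(x, y), (y, x)} \<union> path_arcs (y # zs)"
| "path_arcs _ = {}"

lemma path_arcs_subset: "path_arcs xs \<subseteq> set xs \<times> set xs"
  by (induction xs rule: path_arcs.induct) auto

lemma path_arcs_subset_walk:
  assumes "sym E" "walk E xs"
  shows "path_arcs xs \<subseteq> E"
  using assms(2) by (induction xs rule: path_arcs.induct) (use assms(1) in \<open>auto dest: symD\<close>)

text \<open>For empty \<open>xs\<close> the two removed arcs return as
  \<open>path_arcs [u, v]\<close>, so undivided edges are no special case.\<close>

definition subdivide_path :: "'a pair_pre_digraph \<Rightarrow> 'a \<Rightarrow> 'a list \<Rightarrow> 'a \<Rightarrow> 'a pair_pre_digraph" where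
  "subdivide_path H u xs v = \<lparr>pverts = pverts H \<union> set xs,
     parcs = (parcs H - {(u, v), (v, u)}) \<union> path_arcs (u # xs @ [v])\<rparr>"

lemma pverts_subdivide_path [simp]: "pverts (subdivide_path H u xs v) = pverts H \<union> set xs"
  and parcs_subdivide_path [simp]:
    "parcs (subdivide_path H u xs v) = (parcs H - {(u, v), (v, u)}) \<union> path_arcs (u # xs @ [v])"
  by (simp_all add: subdivide_path_def)

lemma parcs_subdivide_path_subset:
  assumes "parcs H \<subseteq> insert (u, v) (insert (v, u) A)" "path_arcs (u # xs @ [v]) \<subseteq> A"
  shows "parcs (subdivide_path H u xs v) \<subseteq> A"
  using assms by auto

text \<open>A single subdivision puts the first vertex \<open>w\<close> on the edge; the remaining
  list then subdivides the new edge from \<open>w\<close> to \<open>v\<close>.\<close>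

lemma subdivision_pair_subdivide_path:
  assumes "subdivision_pair K H" "(u, v) \<in> parcs H" "distinct xs" "set xs \<inter> pverts H = {}"
  shows "subdivision_pair K (subdivide_path H u xs v)"
  using assms
proof (induction xs arbitrary: u H)
  case Nil
  interpret H: pair_bidirected_digraph H
    using Nil(1) by (rule bidirected_digraphI_subdivision)
  have "subdivide_path H u [] v = H"
    using Nil H.arcs_symmetric by (auto simp: subdivide_path_def intro!: pair_pre_digraph.equality)
  then show ?case using Nil by simp
next
  case (Cons w xs)
  interpret H: pair_bidirected_digraph H
    using Cons(2) by (rule bidirected_digraphI_subdivision)
  let ?H = "subdivide H (u, v) w"
  have ends: "u \<in> pverts H" "v \<in> pverts H" "u \<noteq> v" "w \<notin> pverts H"
    using Cons.prems H.no_loops' by (auto dest: H.in_arcsD1 H.in_arcsD2)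
  have "subdivision_pair K ?H"
    using Cons.prems by (intro subdivision_pair_divide) auto
  then have "subdivision_pair K (subdivide_path ?H w xs v)"
    using Cons.prems ends by (intro Cons.IH) auto
  moreover have "subdivide_path ?H w xs v = subdivide_path H u (w # xs) v"
  proof (rule pair_pre_digraph.equality)
    have fresh: "(w, v) \<notin> parcs H" "(v, w) \<notin> parcs H"
      using ends by (auto dest: H.in_arcsD1 H.in_arcsD2)
    show "parcs (subdivide_path ?H w xs v) = parcs (subdivide_path H u (w # xs) v)"
    proof (cases xs)
      case Nil
      then show ?thesis using fresh ends by auto
    next
      case (Cons z zs)
      have "(u, w) \<notin> {(w, v), (v, w)}" "(w, u) \<notin> {(w, v), (v, w)}" using ends by auto
      moreover have "(parcs ?H - {(w, v), (v, w)}) = (parcs H - {(u, v), (v, u)}) \<union> {(u, w), (w, u)}"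
        using fresh ends by auto
      ultimately show ?thesis by auto
    qed
  qed auto
  ultimately show ?case by simp
qed

text \<open>The edges of the complete \<open>K\<close> are replaced one by one. They need not belong
  to \<open>E\<close>, so the invariant \<open>A\<close> allows arcs outside \<open>E\<close> only
  for edges still to be replaced; \<open>F\<close> says that these edges are still present, and
  \<open>D\<close> that the next inner vertices are new.\<close>

lemma K4_subdivision_of_K4_on:
  assumes "K4_on E S" "sym E"
  obtains H where "K4_subdivision H" "pverts H = S" "parcs H \<subseteq> E"
proof -
  obtain a b c d P1 P2 P3 P4 Q1 Q2 where
    dist: "distinct (a # b # c # d # P1 @ P2 @ P3 @ P4 @ Q1 @ Q2)" and
    S: "S = set (a # b # c # d # P1 @ P2 @ P3 @ P4 @ Q1 @ Q2)" and
    w: "walk E (a # P1 @ [b])" "walk E (b # P2 @ [c])" "walk E (c # P3 @ [d])" "walk E (d # P4 @ [a])"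
      "walk E (a # Q1 @ [c])" "walk E (b # Q2 @ [d])"
    using assms unfolding K4_on_def by blast
  have ne: "a \<noteq> b" "a \<noteq> c" "a \<noteq> d" "b \<noteq> c" "b \<noteq> d" "c \<noteq> d" using dist by auto
  let ?V = "{a, b, c, d}"
  define K where "K = \<lparr>pverts = ?V, parcs = {(u, v). (u, v) \<in> ?V \<times> ?V \<and> u \<noteq> v}\<rparr>"
  have K: "complete_digraph 4 (with_proj K)"
    unfolding complete_digraph_pair_def K_def using ne by (auto simp: card_insert_if)
  then interpret pair_graph K
    by (intro pair_graphI_graph) (simp add: complete_digraph_def)
  have D6: "distinct (([a, b, c, d] @ P1 @ P2 @ P3 @ P4 @ Q1) @ Q2)" using dist by (simp only: append.simps append_assoc)
  have D5: "distinct (([a, b, c, d] @ P1 @ P2 @ P3 @ P4) @ Q1)"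
    using D6[unfolded distinct_append[of _ Q2]] by (simp only: append_assoc)
  have D4: "distinct (([a, b, c, d] @ P1 @ P2 @ P3) @ P4)"
    using D5[unfolded distinct_append[of _ Q1]] by (simp only: append_assoc)
  have D3: "distinct (([a, b, c, d] @ P1 @ P2) @ P3)"
    using D4[unfolded distinct_append[of _ P4]] by (simp only: append_assoc)
  have D2: "distinct (([a, b, c, d] @ P1) @ P2)"
    using D3[unfolded distinct_append[of _ P3]] by (simp only: append_assoc)
  have D1: "distinct (([a, b, c, d]) @ P1)"
    using D2[unfolded distinct_append[of _ P2]] by (simp only: append_assoc)
  note arcs = w[THEN path_arcs_subset_walk[OF assms(2)]]
  have S0: "subdivision_pair K K"
    by (rule subdivision_pair_base) unfold_locales
  have V0: "pverts K = set [a, b, c, d]" by (simp add: K_def)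
  have F0: "{(a, b), (b, c), (c, d), (d, a), (a, c), (b, d)} \<subseteq> parcs K" using ne by (simp add: K_def)
  have A0: "parcs K \<subseteq> {(a, b), (b, a), (b, c), (c, b), (c, d), (d, c), (d, a), (a, d), (a, c), (c, a),
      (b, d), (d, b)} \<union> E"
    by (auto simp: K_def)
  define H1 where "H1 = subdivide_path K a P1 b"
  have S1: "subdivision_pair K H1"
    unfolding H1_def using S0 by (rule subdivision_pair_subdivide_path) 
    (use D1[unfolded distinct_append[of _ P1]] F0 in \<open>simp_all only: V0 Int_commute insert_subset\<close>)
  have V1: "pverts H1 = set ([a, b, c, d] @ P1)"
    unfolding H1_def pverts_subdivide_path V0 by (simp only: set_append Un_assoc)
  have F1: "{(b, c), (c, d), (d, a), (a, c), (b, d)} \<subseteq> parcs H1"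
    unfolding H1_def parcs_subdivide_path using F0 ne by blast
  have A1: "parcs H1 \<subseteq> {(b, c), (c, b), (c, d), (d, c), (d, a), (a, d), (a, c), (c, a), (b, d), (d, b)} \<union> E"
    unfolding H1_def by (rule parcs_subdivide_path_subset) (use A0 in simp, rule le_supI2[OF arcs(1)])
  define H2 where "H2 = subdivide_path H1 b P2 c"
  have S2: "subdivision_pair K H2"
    unfolding H2_def using S1 by (rule subdivision_pair_subdivide_path) 
    (use D2[unfolded distinct_append[of _ P2]] F1 in \<open>simp_all only: V1 Int_commute insert_subset\<close>)
  have V2: "pverts H2 = set ([a, b, c, d] @ P1 @ P2)"
    unfolding H2_def pverts_subdivide_path V1 by (simp only: set_append Un_assoc)
  have F2: "{(c, d), (d, a), (a, c), (b, d)} \<subseteq> parcs H2"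
    unfolding H2_def parcs_subdivide_path using F1 ne by blast
  have A2: "parcs H2 \<subseteq> {(c, d), (d, c), (d, a), (a, d), (a, c), (c, a), (b, d), (d, b)} \<union> E"
    unfolding H2_def by (rule parcs_subdivide_path_subset) (use A1 in simp, rule le_supI2[OF arcs(2)])
  define H3 where "H3 = subdivide_path H2 c P3 d"
  have S3: "subdivision_pair K H3"
    unfolding H3_def using S2 by (rule subdivision_pair_subdivide_path) 
    (use D3[unfolded distinct_append[of _ P3]] F2 in \<open>simp_all only: V2 Int_commute insert_subset\<close>)
  have V3: "pverts H3 = set ([a, b, c, d] @ P1 @ P2 @ P3)"
    unfolding H3_def pverts_subdivide_path V2 by (simp only: set_append Un_assoc)
  have F3: "{(d, a), (a, c), (b, d)} \<subseteq> parcs H3"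
    unfolding H3_def parcs_subdivide_path using F2 ne by blast
  have A3: "parcs H3 \<subseteq> {(d, a), (a, d), (a, c), (c, a), (b, d), (d, b)} \<union> E"
    unfolding H3_def by (rule parcs_subdivide_path_subset) (use A2 in simp, rule le_supI2[OF arcs(3)])
  define H4 where "H4 = subdivide_path H3 d P4 a"
  have S4: "subdivision_pair K H4"
    unfolding H4_def using S3 by (rule subdivision_pair_subdivide_path) 
    (use D4[unfolded distinct_append[of _ P4]] F3 in \<open>simp_all only: V3 Int_commute insert_subset\<close>)
  have V4: "pverts H4 = set ([a, b, c, d] @ P1 @ P2 @ P3 @ P4)"
    unfolding H4_def pverts_subdivide_path V3 by (simp only: set_append Un_assoc)
  have F4: "{(a, c), (b, d)} \<subseteq> parcs H4"
    unfolding H4_def parcs_subdivide_path using F3 ne by blast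
  have A4: "parcs H4 \<subseteq> {(a, c), (c, a), (b, d), (d, b)} \<union> E"
    unfolding H4_def by (rule parcs_subdivide_path_subset) (use A3 in simp, rule le_supI2[OF arcs(4)])
  define H5 where "H5 = subdivide_path H4 a Q1 c"
  have S5: "subdivision_pair K H5"
    unfolding H5_def using S4 by (rule subdivision_pair_subdivide_path) 
    (use D5[unfolded distinct_append[of _ Q1]] F4 in \<open>simp_all only: V4 Int_commute insert_subset\<close>)
  have V5: "pverts H5 = set ([a, b, c, d] @ P1 @ P2 @ P3 @ P4 @ Q1)"
    unfolding H5_def pverts_subdivide_path V4 by (simp only: set_append Un_assoc)
  have F5: "{(b, d)} \<subseteq> parcs H5"
    unfolding H5_def parcs_subdivide_path using F4 ne by blast
  have A5: "parcs H5 \<subseteq> {(b, d), (d, b)} \<union> E"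
    unfolding H5_def by (rule parcs_subdivide_path_subset) (use A4 in simp, rule le_supI2[OF arcs(5)])
  define H6 where "H6 = subdivide_path H5 b Q2 d"
  have S6: "subdivision_pair K H6"
    unfolding H6_def using S5 by (rule subdivision_pair_subdivide_path) 
    (use D6[unfolded distinct_append[of _ Q2]] F5 in \<open>simp_all only: V5 Int_commute insert_subset\<close>)
  have V6: "pverts H6 = set ([a, b, c, d] @ P1 @ P2 @ P3 @ P4 @ Q1 @ Q2)"
    unfolding H6_def pverts_subdivide_path V5 by (simp only: set_append Un_assoc)
  have "parcs H6 \<subseteq> E"
    unfolding H6_def by (rule parcs_subdivide_path_subset) (use A5 arcs(6) in simp_all)
  moreover have "K4_subdivision H6"
    using K S6 unfolding K4_subdivision_def by blast
  moreover have "pverts H6 = S"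
    unfolding S V6 by auto
  ultimately show thesis by (intro that)
qed

subsection \<open>Plane drawings\<close>

lemma connected_UN_adjacent:
  assumes "connected_on E R" "\<And>r. r \<in> R \<Longrightarrow> Topological_Spaces.connected (S r)"
    and "\<And>u v. u \<in> R \<Longrightarrow> v \<in> R \<Longrightarrow> (u, v) \<in> E \<Longrightarrow> S u \<inter> S v \<noteq> {}"
  shows "Topological_Spaces.connected (\<Union>r\<in>R. S r)"
proof -
  let ?U = "\<Union>r\<in>R. S r"
  have same: "connected_component ?U x y" if "r \<in> R" "x \<in> S r" "y \<in> S r" for r x y
    unfolding connected_component_def using assms(2) that by blast
  have "\<forall>y\<in>S v. connected_component ?U x y" if "(u, v) \<in> rtrancl_on R E" "x \<in> S u" for u v x
    using that
  proof (induct rule: rtrancl_on_induct)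
    case base
    then show ?case using same by blast
  next
    case (step y z)
    obtain w where "w \<in> S y" "w \<in> S z" using assms(3)[of y z] step by auto
    then have "connected_component ?U x w" "\<forall>q\<in>S z. connected_component ?U w q"
      using step same by blast+
    then show ?case using connected_component_trans by blast
  qed
  then show ?thesis
    using assms(1) unfolding connected_iff_connected_component connected_on_def by blast
qed

locale plane_graph = pair_graph +
  fixes p :: "'a \<Rightarrow> complex" and g :: "'a \<times> 'a \<Rightarrow> real \<Rightarrow> complex"
  assumes drawing: "plane_drawing G p g"
begin

lemma p_eq_iff: "u \<in> pverts G \<Longrightarrow> v \<in> pverts G \<Longrightarrow> p u = p v \<longleftrightarrow> u = v"
  using drawing by (auto simp: plane_drawing_def inj_on_def)

lemma drawing_arc:
  assumes "(u, v) \<in> parcs G"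
  shows "Path_Connected.arc (g (u, v))" "pathstart (g (u, v)) = p u" "pathfinish (g (u, v)) = p v"
    "path_image (g (v, u)) = path_image (g (u, v))" "p u \<in> path_image (g (u, v))" "p v \<in> path_image (g (u, v))"
proof -
  show g: "Path_Connected.arc (g (u, v))" "pathstart (g (u, v)) = p u" "pathfinish (g (u, v)) = p v"
    using drawing assms by (auto simp: plane_drawing_def)
  have "g (v, u) = reversepath (g (u, v))"
    using drawing assms by (auto simp: plane_drawing_def)
  then show "path_image (g (v, u)) = path_image (g (u, v))" by simp
  show "p u \<in> path_image (g (u, v))" "p v \<in> path_image (g (u, v))"
    using g pathstart_in_path_image pathfinish_in_path_image by metis+
qed

lemma drawing_vertex:
  assumes "(u, v) \<in> parcs G" "w \<in> pverts G" "p w \<in> path_image (g (u, v))"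
  shows "w = u \<or> w = v"
proof -
  have "(path_image (g (u, v)) - {p u, p v}) \<inter> p ` pverts G = {}"
    using drawing assms(1) unfolding plane_drawing_def by blast
  then have "p w = p u \<or> p w = p v" using assms by blast
  then show ?thesis using assms p_eq_iff by (auto dest: in_arcsD1 in_arcsD2)
qed

text \<open>The interior of the first edge avoids the second, so \<open>z\<close> is an end of the
  first; and a vertex on the second edge is one of its ends.\<close>

lemma drawing_Int:
  assumes "(u, v) \<in> parcs G" "(x, y) \<in> parcs G" "{x, y} \<noteq> {u, v}"
    and "z \<in> path_image (g (u, v))" "z \<in> path_image (g (x, y))"
  obtains w where "z = p w" "w \<in> {u, v}" "w \<in> {x, y}"
proof -
  have "\<forall>(x, y)\<in>parcs G. {x, y} \<noteq> {u, v} \<longrightarrow>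
      (path_image (g (u, v)) - {p u, p v}) \<inter> path_image (g (x, y)) = {}"
    using drawing assms(1) unfolding plane_drawing_def by blast
  then have "(path_image (g (u, v)) - {p u, p v}) \<inter> path_image (g (x, y)) = {}"
    using assms(2,3) by blast
  then obtain w where w: "z = p w" "w \<in> {u, v}"
    using assms(4,5) by blast
  then have "w \<in> {x, y}"
    using drawing_vertex[OF assms(2), of w] assms by (auto dest: in_arcsD1 in_arcsD2)
  then show thesis using that w by blast
qed

definition path_region :: "'a list \<Rightarrow> complex set" where
  "path_region xs = (\<Union>e\<in>path_arcs xs. path_image (g e))"

lemma path_arcs_parcs: "walk (parcs G) xs \<Longrightarrow> path_arcs xs \<subseteq> parcs G"
  by (rule path_arcs_subset_walk) (use arcs_symmetric in \<open>auto intro: symI\<close>)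

text \<open>Arcs can be joined one at a time, because the first edge meets the drawing of the
  remaining path only in \<open>p y\<close>.\<close>

lemma drawing_walk:
  assumes "walk (parcs G) xs" "distinct xs" "length xs \<ge> 2"
  obtains c where "Path_Connected.arc c" "pathstart c = p (hd xs)" "pathfinish c = p (last xs)"
    "path_image c = path_region xs"
proof -
  have "\<exists>c. Path_Connected.arc c \<and> pathstart c = p (hd xs) \<and> pathfinish c = p (last xs) \<and> path_image c = path_region xs"
    using assms
  proof (induction xs rule: path_arcs.induct)
    case (1 x y zs)
    have xy: "(x, y) \<in> parcs G" using 1 by simp
    note gxy = drawing_arc[OF xy]
    show ?case
    proof (cases zs)
      case Nil
      then show ?thesis
        using gxy by (intro exI[of _ "g (x, y)"]) (auto simp: path_region_def)
    next
      case (Cons z ws)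
      then obtain c where c: "Path_Connected.arc c" "pathstart c = p y" "pathfinish c = p (last (y # zs))"
        "path_image c = path_region (y # zs)"
        using 1 by auto
      have "path_image (g (x, y)) \<inter> path_image c \<subseteq> {p y}"
      proof
        fix q assume q: "q \<in> path_image (g (x, y)) \<inter> path_image c"
        then obtain e where e: "e \<in> path_arcs (y # zs)" "q \<in> path_image (g e)"
          by (auto simp: c path_region_def)
        obtain u v where uv: "e = (u, v)" by (cases e)
        have "(u, v) \<in> parcs G" using path_arcs_parcs[of "y # zs"] 1 e uv by auto
        moreover have "u \<in> set (y # zs)" "v \<in> set (y # zs)"
          using e uv path_arcs_subset[of "y # zs"] by blast+
        then have uvx: "u \<noteq> x" "v \<noteq> x" using 1 by auto
        then have "{u, v} \<noteq> {x, y}" by auto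
        ultimately obtain w where "q = p w" "w \<in> {x, y}" "w \<in> {u, v}"
          using drawing_Int[OF xy, of u v q] q e uv by blast
        then show "q \<in> {p y}" using uvx by auto
      qed
      then have "Path_Connected.arc (g (x, y) +++ c)"
        using c gxy by (intro arc_join) auto
      moreover have "path_image (g (x, y) +++ c) = path_region (x # y # zs)"
        using c gxy by (auto simp: path_image_join path_region_def)
      ultimately show ?thesis
        using c gxy by (intro exI[of _ "g (x, y) +++ c"]) auto
    qed
  qed auto
  then show thesis using that by blast
qed

lemma vertex_in_path_region:
  assumes "walk (parcs G) xs" "length xs \<ge> 2" "v \<in> set xs"
  shows "p v \<in> path_region xs"
  using assms
proof (induction xs rule: path_arcs.induct)
  case (1 x y zs)
  have "(x, y) \<in> parcs G" using 1 by simp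
  then show ?case
    using 1 drawing_arc[of x y] by (cases zs) (auto simp: path_region_def)
qed auto

text \<open>Each edge of the first path has an end in the nonempty \<open>xs\<close>, so it is not
  an edge of the second path. Distinct edges meet only in common ends, and the paths share only
  \<open>a\<close> and \<open>b\<close>.\<close>

lemma path_region_Int:
  assumes "walk (parcs G) (a # xs @ [b])" "walk (parcs G) (a # ys @ [b])"
    and "distinct (a # b # xs @ ys)" "xs \<noteq> []"
  shows "path_region (a # xs @ [b]) \<inter> path_region (a # ys @ [b]) \<subseteq> {p a, p b}"
proof
  fix q assume "q \<in> path_region (a # xs @ [b]) \<inter> path_region (a # ys @ [b])"
  then obtain u v x y where e: "(u, v) \<in> path_arcs (a # xs @ [b])" "(x, y) \<in> path_arcs (a # ys @ [b])"
    "q \<in> path_image (g (u, v))" "q \<in> path_image (g (x, y))"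
    by (auto simp: path_region_def)
  have V: "u \<in> set (a # xs @ [b])" "v \<in> set (a # xs @ [b])" "x \<in> set (a # ys @ [b])" "y \<in> set (a # ys @ [b])"
    using e path_arcs_subset by blast+
  have "u \<in> set xs \<or> v \<in> set xs"
  proof -
    \<comment> \<open>The start \<open>z\<close> is generalised from \<open>a\<close>, since the
      induction moves on to later vertices of the path.\<close>
    have "e \<notin> {a, b} \<times> {a, b}" if "e \<in> path_arcs (z # zs @ [b])" "zs \<noteq> []" "z = a \<or> z \<notin> {a, b}"
        "distinct (z # b # zs)" "a \<notin> set zs" for e z zs
      using that
    proof (induction zs arbitrary: z)
      case (Cons w ws)
      then show ?case by (cases ws) auto
    qed simp
    from this[of "(u, v)" a xs] show ?thesis using e V assms by auto
  qed
  then have "{x, y} \<noteq> {u, v}" using V assms by auto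
  moreover have "(u, v) \<in> parcs G" "(x, y) \<in> parcs G"
    using e assms(1,2)[THEN path_arcs_parcs] by blast+
  ultimately obtain w where "q = p w" "w \<in> {u, v}" "w \<in> {x, y}"
    using drawing_Int e by metis
  then show "q \<in> {p a, p b}" using V assms by auto
qed

text \<open>The far ends are left out so that the stars of \<open>R\<close> avoid the drawn paths
  and yet have the attachment vertices in their closure.\<close>

definition star_region :: "'a \<Rightarrow> complex set" where
  "star_region u = insert (p u) (\<Union>v\<in>{v. (u, v) \<in> parcs G}. path_image (g (u, v)) - {p v})"

lemma half_open_arc:
  assumes "(u, v) \<in> parcs G"
  shows "Topological_Spaces.connected (path_image (g (u, v)) - {p v})"
    "p v \<in> closure (path_image (g (u, v)) - {p v})"
proof -
  note guv = drawing_arc[OF assms]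
  have cont: "continuous_on {0..1} (g (u, v))" and inj: "inj_on (g (u, v)) {0..1}"
    using guv(1) by (auto simp: Path_Connected.arc_def Path_Connected.path_def)
  have g1: "g (u, v) 1 = p v" using guv(3) by (simp add: pathfinish_def)
  have eq: "path_image (g (u, v)) - {p v} = g (u, v) ` {0..<1}"
  proof -
    have "g (u, v) ` {0..1} - {g (u, v) 1} = g (u, v) ` ({0..1} - {1})"
      using inj by (auto simp: inj_on_def)
    moreover have "{0..1} - {1} = {0..<1::real}" by auto
    ultimately show ?thesis by (simp add: path_image_def g1)
  qed
  show "Topological_Spaces.connected (path_image (g (u, v)) - {p v})"
    unfolding eq by (rule connected_continuous_image) (auto intro: continuous_on_subset[OF cont])
  have "g (u, v) ` closure {0..<1} \<subseteq> closure (g (u, v) ` {0..<1})"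
  proof (rule image_closure_subset)
    show "g (u, v) ` {0..<1} \<subseteq> closure (g (u, v) ` {0..<1})" by (rule closure_subset)
  qed (use cont in auto)
  then show "p v \<in> closure (path_image (g (u, v)) - {p v})"
    unfolding eq using image_eqI[of "p v" "g (u, v)" 1 "{0..1}"] g1 by (auto simp: closure_atLeastLessThan)
qed

lemma connected_star_region: "Topological_Spaces.connected (star_region u)"
proof -
  let ?F = "insert {p u} ((\<lambda>v. path_image (g (u, v)) - {p v}) ` {v. (u, v) \<in> parcs G})"
  have "p u \<in> path_image (g (u, v)) - {p v}" if "(u, v) \<in> parcs G" for v
    using drawing_arc[OF that] p_eq_iff[OF in_arcsD1[OF that] in_arcsD2[OF that]] no_loops'[OF that] by simp
  then have "\<Inter> ?F \<noteq> {}" by blast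
  then have "Topological_Spaces.connected (\<Union> ?F)"
    by (intro connected_Union) (use half_open_arc in auto)
  moreover have "\<Union> ?F = star_region u" by (auto simp: star_region_def)
  ultimately show ?thesis by simp
qed

text \<open>The three paths are drawn as a theta curve. The union of the stars of \<open>R\<close>
  is connected, avoids this curve and touches the interior of all three arcs, which
  \<open>theta_curve_face\<close> excludes.\<close>

lemma no_K33_plane:
  assumes dist: "distinct (a # b # P @ Q @ S)"
    and w: "walk (parcs G) (a # P @ [b])" "walk (parcs G) (a # Q @ [b])" "walk (parcs G) (a # S @ [b])"
    and R: "connected_on (parcs G) R" "R \<subseteq> pverts G" "R \<inter> set (a # b # P @ Q @ S) = {}"
    and N: "nbrs (parcs G) R \<inter> set P \<noteq> {}" "nbrs (parcs G) R \<inter> set Q \<noteq> {}" "nbrs (parcs G) R \<inter> set S \<noteq> {}"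
  shows False
proof -
  have ne: "P \<noteq> []" "Q \<noteq> []" "S \<noteq> []" using N by auto
  let ?U = "\<Union>r\<in>R. star_region r"
  have conU: "Topological_Spaces.connected ?U"
  proof (rule connected_UN_adjacent[OF R(1) connected_star_region])
    fix u v assume uv: "u \<in> R" "v \<in> R" "(u, v) \<in> parcs G"
    have ne_uv: "p u \<noteq> p v" using uv p_eq_iff no_loops' R(2) by blast
    have "p v \<in> closure (path_image (g (u, v)) - {p v})" by (rule half_open_arc(2)[OF uv(3)])
    \<comment> \<open>A point of the edge closer to \<open>p v\<close> than \<open>p u\<close> is,
      but different from \<open>p v\<close>, is neither end, so it lies in both stars.\<close>
    then obtain q where "q \<in> path_image (g (u, v)) - {p v}" "dist q (p v) < dist (p u) (p v)"
      using ne_uv unfolding closure_approachable by (metis zero_less_dist_iff)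
    then have "q \<in> path_image (g (u, v)) - {p v}" "q \<in> path_image (g (v, u)) - {p u}"
      using drawing_arc(4)[OF uv(3)] by auto
    then show "star_region u \<inter> star_region v \<noteq> {}"
      using uv arcs_symmetric[OF uv(3)] unfolding star_region_def by blast
  qed
  have arc: "\<exists>c. Path_Connected.arc c \<and> pathstart c = p a \<and> pathfinish c = p b \<and> path_image c = path_region (a # xs @ [b])"
    if "walk (parcs G) (a # xs @ [b])" "distinct (a # xs @ [b])" for xs
    using drawing_walk[OF that] by auto
  obtain c1 c2 c3 where
    c1: "Path_Connected.arc c1" "pathstart c1 = p a" "pathfinish c1 = p b" "path_image c1 = path_region (a # P @ [b])" and
    c2: "Path_Connected.arc c2" "pathstart c2 = p a" "pathfinish c2 = p b" "path_image c2 = path_region (a # Q @ [b])" and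
    c3: "Path_Connected.arc c3" "pathstart c3 = p a" "pathfinish c3 = p b" "path_image c3 = path_region (a # S @ [b])"
    using arc[OF w(1)] arc[OF w(2)] arc[OF w(3)] dist by auto
  \<comment> \<open>A common point lies on an edge at some \<open>r\<close> in \<open>R\<close> and
    on a path edge. These differ, as \<open>r\<close> is not on the path, so the point is a common
    end; but it is not \<open>p r\<close>, and the star omits the far end.\<close>
  have disj: "?U \<inter> path_region (a # xs @ [b]) = {}"
    if xs: "walk (parcs G) (a # xs @ [b])" "set xs \<subseteq> set (P @ Q @ S)" for xs
  proof (rule ccontr)
    assume "\<not> ?thesis"
    then obtain r q x y where rq: "r \<in> R" "q \<in> star_region r" "(x, y) \<in> path_arcs (a # xs @ [b])" "q \<in> path_image (g (x, y))"
      by (auto simp: path_region_def)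
    have xy: "(x, y) \<in> parcs G" using path_arcs_parcs[OF xs(1)] rq by blast
    have "x \<in> set (a # xs @ [b])" "y \<in> set (a # xs @ [b])" using rq path_arcs_subset by blast+
    then have rxy: "r \<noteq> x" "r \<noteq> y" using R(3) rq xs(2) by auto
    have "q \<noteq> p r" using drawing_vertex[OF xy, of r] rq R(2) rxy by auto
    then obtain v where v: "(r, v) \<in> parcs G" "q \<in> path_image (g (r, v))" "q \<noteq> p v"
      using rq by (auto simp: star_region_def)
    have "{x, y} \<noteq> {r, v}" using rxy by auto
    then obtain w where "q = p w" "w \<in> {r, v}" "w \<in> {x, y}"
      using drawing_Int[OF v(1) xy _ v(2) rq(4)] by blast
    then show False using rxy v \<open>q \<noteq> p r\<close> by auto
  qed
  have touch: "closure ?U \<inter> (path_region (a # xs @ [b]) - {p a, p b}) \<noteq> {}"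
    if xs: "walk (parcs G) (a # xs @ [b])" "nbrs (parcs G) R \<inter> set xs \<noteq> {}" "a \<notin> set xs" "b \<notin> set xs" for xs
  proof -
    obtain r s where rs: "r \<in> R" "s \<in> set xs" "(r, s) \<in> parcs G" using xs(2) by (auto simp: nbrs_def)
    have "p s \<in> closure (path_image (g (r, s)) - {p s})" by (rule half_open_arc(2)[OF rs(3)])
    moreover have "path_image (g (r, s)) - {p s} \<subseteq> ?U" using rs by (auto simp: star_region_def)
    ultimately have "p s \<in> closure ?U" using closure_mono by blast
    moreover have "p s \<in> path_region (a # xs @ [b])" using vertex_in_path_region[OF xs(1)] rs by auto
    moreover have "a \<in> pverts G" "b \<in> pverts G" "s \<in> pverts G"
    proof -
      show "s \<in> pverts G" using rs in_arcsD2 by blast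
      have "xs \<noteq> []" using rs by auto
      then have "(a, hd xs) \<in> parcs G" "(last xs, b) \<in> parcs G"
        using xs(1) by (auto simp: successively_Cons successively_append_iff)
      then show "a \<in> pverts G" "b \<in> pverts G" using in_arcsD1 in_arcsD2 by blast+
    qed
    then have "p s \<notin> {p a, p b}" using p_eq_iff rs xs(3,4) by auto
    ultimately show ?thesis by blast
  qed
  show False
  proof (rule theta_curve_face[OF c1(1-3) c2(1-3) c3(1-3) _ _ _ conU])
    show "path_image c1 \<inter> path_image c2 \<subseteq> {p a, p b}" "path_image c1 \<inter> path_image c3 \<subseteq> {p a, p b}"
      "path_image c2 \<inter> path_image c3 \<subseteq> {p a, p b}"
      unfolding c1(4) c2(4) c3(4) using path_region_Int[OF w(1,2)] path_region_Int[OF w(1,3)] path_region_Int[OF w(2,3)] dist ne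
      by auto
    show "?U \<inter> (path_image c1 \<union> path_image c2 \<union> path_image c3) = {}"
      unfolding c1(4) c2(4) c3(4) using disj[OF w(1)] disj[OF w(2)] disj[OF w(3)] by auto
    show "closure ?U \<inter> (path_image c1 - {p a, p b}) \<noteq> {}" "closure ?U \<inter> (path_image c2 - {p a, p b}) \<noteq> {}"
      "closure ?U \<inter> (path_image c3 - {p a, p b}) \<noteq> {}"
      unfolding c1(4) c2(4) c3(4) using touch[OF w(1) N(1)] touch[OF w(2) N(2)] touch[OF w(3) N(3)] dist
      by auto
  qed
qed

end

section \<open>Connectivity and components after deleting vertices\<close>

lemma connected_delete_verts_iff:
  assumes "pair_graph G"
  shows "Digraph_Component.connected (delete_verts G X) \<longleftrightarrow>
    pverts G - X \<noteq> {} \<and> connected_on (parcs G) (pverts G - X)"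
proof -
  interpret pair_graph G by fact
  let ?S = "pverts G - X" and ?D = "delete_verts G X"
  have vD: "verts ?D = ?S" by (simp add: delete_verts_def)
  have aD: "arcs_ends ?D = parcs G \<inter> ?S \<times> ?S"
    by (auto simp: delete_verts_def arcs_ends_conv)
  have "rtrancl_on ?S ((arcs_ends ?D)\<^sup>s) = rtrancl_on ?S (parcs G)"
  proof (intro set_eqI iffI; clarify)
    fix x y
    { assume "(x, y) \<in> rtrancl_on ?S ((arcs_ends ?D)\<^sup>s)"
      then show "(x, y) \<in> rtrancl_on ?S (parcs G)"
        by (rule rtrancl_on_mono[rotated 2]) (use arcs_symmetric in \<open>auto simp: aD symcl_def\<close>) }
    { assume "(x, y) \<in> rtrancl_on ?S (parcs G)"
      then show "(x, y) \<in> rtrancl_on ?S ((arcs_ends ?D)\<^sup>s)"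
        by (induct rule: rtrancl_on_induct) (auto simp: aD symcl_def intro: rtrancl_on_into_rtrancl_on) }
  qed
  then show ?thesis
    unfolding connected_conv vD connected_on_def by auto
qed

text \<open>A nonempty remainder is strongly connected as a whole, so by maximality it is its only
  component; an empty remainder has none.\<close>

lemma num_components_connected:
  assumes "pair_graph G" "connected_on (parcs G) (pverts G - X)"
  shows "num_components (delete_verts G X) < 2"
proof -
  interpret pair_graph G by fact
  let ?D = "delete_verts G X"
  have sc: "strongly_connected ?D" if "pverts G - X \<noteq> {}"
  proof -
    have "\<forall>x\<in>pverts G - X. \<forall>y\<in>pverts G - X. (x, y) \<in> rtrancl_on (pverts G - X) (arcs_ends ?D)"
    proof (intro ballI)
      fix x y assume "x \<in> pverts G - X" "y \<in> pverts G - X"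
      then have "(x, y) \<in> rtrancl_on (pverts G - X) (parcs G)"
        using assms(2) by (auto simp: connected_on_def)
      then show "(x, y) \<in> rtrancl_on (pverts G - X) (arcs_ends ?D)"
        by (induct rule: rtrancl_on_induct)
          (auto simp: delete_verts_def arcs_ends_conv intro: rtrancl_on_into_rtrancl_on)
    qed
    then show ?thesis
      using that by (auto simp: strongly_connected_def reachable_def delete_verts_def)
  qed
  have wf: "wf_digraph ?D" unfolding delete_verts_def by (rule wellformed_induce_subgraph)
  have "pre_digraph.sccs ?D \<subseteq> {?D}"
  proof
    fix H assume H: "H \<in> pre_digraph.sccs ?D"
    then have ind: "induced_subgraph H ?D" "strongly_connected H"
      and max: "\<And>H'. induced_subgraph H' ?D \<Longrightarrow> strongly_connected H' \<Longrightarrow> \<not> verts H \<subset> verts H'"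
      by (auto simp: pre_digraph.sccs_def)
    have sub: "subgraph H ?D" using ind by (rule_tac induced_imp_subgraph)
    have "verts H \<noteq> {}" using ind by (auto simp: strongly_connected_def)
    moreover have vs: "verts H \<subseteq> verts ?D" using sub by auto
    ultimately have "verts ?D \<noteq> {}" by auto
    then have "strongly_connected ?D" by (intro sc) (simp add: delete_verts_def)
    moreover have "induced_subgraph ?D ?D"
      using wf by (auto simp: induced_subgraph_def subgraph_def compatible_def dest: wf_digraph.wellformed)
    ultimately have "verts H = verts ?D" using max vs by blast
    moreover have "arcs H = arcs ?D"
      using ind(1) wf calculation by (auto simp: induced_subgraph_def dest: wf_digraph.wellformed)
    moreover have "tail H = tail ?D" "head H = head ?D"
      using sub by (auto simp: subgraph_def compatible_def)
    ultimately show "H \<in> {?D}" by simp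
  qed
  then have "card (pre_digraph.sccs ?D) \<le> card {?D}" by (intro card_mono) auto
  then show ?thesis by (simp add: num_components_def)
qed

theorem theorem7:
  fixes G :: "'a pair_pre_digraph"
  assumes "pair_graph G" and "k_connected 3 G" and "planar G"
  shows "\<exists>H :: 'a pair_pre_digraph.
           subgraph (with_proj H) (with_proj G) \<and> K4_subdivision H \<and>
           num_components (delete_verts G (pverts H)) < 2"
proof -
  interpret pair_graph G by fact
  obtain p g where "plane_drawing G p g" using assms(3) by (auto simp: planar_def)
  then interpret plane_graph G p g by unfold_locales
  have sym: "sym (parcs G)" using arcs_symmetric by (auto intro: symI)
  \<comment> \<open>Planarity enters the combinatorial argument only here, through
    \<open>no_K33_plane\<close>.\<close>
  interpret K: three_connected_K33_free "pverts G" "parcs G"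
  proof
    show "finite (pverts G)" by (rule pair_finite_verts)
    show "parcs G \<subseteq> pverts G \<times> pverts G" using in_arcsD1 in_arcsD2 by auto
    show "sym (parcs G)" by fact
    show "3 < card (pverts G)" using assms(2) by (simp add: k_connected_def)
    show "connected_on (parcs G) (pverts G - X)" if "X \<subseteq> pverts G" "card X \<le> 2" for X
    proof -
      have "Digraph_Component.connected (delete_verts G X)"
        using assms(2) that by (simp add: k_connected_def)
      then show ?thesis using connected_delete_verts_iff[OF assms(1)] by blast
    qed
  qed (rule no_K33_plane)
  obtain S where S: "S \<subseteq> pverts G" "K4_on (parcs G) S" "connected_on (parcs G) (pverts G - S)"
    using K.K4_on_nonseparating by blast
  obtain H where H: "K4_subdivision H" "pverts H = S" "parcs H \<subseteq> parcs G"
    using K4_subdivision_of_K4_on[OF S(2) sym] .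
  \<comment> \<open>A subgraph has to be well formed; \<open>H\<close> is, because subdivisions are
    bidirected digraphs.\<close>
  have "wf_digraph (with_proj H)"
    using H(1) subdivision_bidir bidirected_digraph.axioms(1) unfolding K4_subdivision_def by blast
  then have "subgraph (with_proj H) (with_proj G)"
    using H S(1) wf_digraph_axioms by (auto simp: subgraph_def compatible_def)
  then show ?thesis
    using H num_components_connected[OF assms(1) S(3)] by blast
qed

end
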